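(* Let $X$ be a Banach space with the alternative Daugavet property, let $T\in\operatorname{Lip}(X)$, and suppose that $\overline{\operatorname{conv}}(\operatorname{slope}(T))$ has one of the following properties: the Radon-Nikodým property, the Asplund property, CPCP, or absence of $\ell_1$-sequences. Then $T$ satisfies the alternative Daugavet equation $\max_{\theta\in\mathbb{T}}\|\mathrm{Id}+\theta T\|=1+\|T\|$.
   Context: $X$ is a Banach space over $\mathbb{K}=\mathbb{R}$ or $\mathbb{C}$, and $\mathbb{T}=\{\theta\in\mathbb{K}:|\theta|=1\}$. $X$ has the alternative Daugavet property if every rank-one bounded linear operator $R:X\to X$ satisfies $\max_{\theta\in\mathbb{T}}\|\mathrm{Id}+\theta R\|=1+\|R\|$. $\operatorname{Lip}(X)$ is the space of Lipschitz maps $T:X\to X$ (not necessarily linear) with the seminorm $\|T\|=\sup\left\{\frac{\|T(x_1)-T(x_2)\|}{\|x_1-x_2\|}:x_1\neq x_2\in X\right\}$ (formally modulo constants, or with $T(0)=0$). $\operatorname{slope}(T):=\left\{\frac{T(x_1)-T(x_2)}{\|x_1-x_2\|}:x_1\neq x_2\in X\right\}$. Properties of a closed bounded convex set $C\subset X$ (standard meanings): $C$ has the Radon-Nikodým property if every non-empty closed convex subset of $C$ is dentable, i.e. has slices (non-empty intersections with open half-spaces) of arbitrarily small diameter. $C$ has the Asplund property if for every countable $B\subset C$ the seminormed space $(X^*,\rho_B)$, $\rho_B(x^* )=\sup_{b\in B}|x^*(b)|$, is separable. $C$ has CPCP (the convex point of continuity property) if every non-empty closed convex subset $D\subset C$ contains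 a point at which the identity map $(D,\text{weak})\to(D,\|\cdot\|)$ is continuous. Absence of $\ell_1$-sequences means that $C$ contains no sequence equivalent to the canonical basis of $\ell_1$. *)

theory Defs
  imports "HOL-Analysis.Analysis"
begin

text \<open>
  The scalar field K: a normed field isometrically isomorphic to the reals or to the complex numbers.
\<close>

class real_or_complex_field = real_normed_field +
  assumes real_or_complex:
    "(\<exists>\<phi>::'a \<Rightarrow> real. bij \<phi> \<and> (\<forall>x y. \<phi> (x + y) = \<phi> x + \<phi> y) \<and>
        (\<forall>x y. \<phi> (x * y) = \<phi> x * \<phi> y) \<and> (\<forall>x. norm (\<phi> x) = norm x)) \<or>
     (\<exists>\<phi>::'a \<Rightarrow> complex. bij \<phi> \<and> (\<forall>x y. \<phi> (x + y) = \<phi> x + \<phi> y) \<and>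
        (\<forall>x y. \<phi> (x * y) = \<phi> x * \<phi> y) \<and> (\<forall>x. norm (\<phi> x) = norm x))"

instance real :: real_or_complex_field
  by standard (rule disjI1, rule exI[of _ id], simp)

instance complex :: real_or_complex_field
  by standard (rule disjI2, rule exI[of _ id], simp)

text \<open>
  The library class for Banach spaces is real. A Banach space over K is a real Banach space
  with a scalar multiplication by K that extends the real one and is compatible with the norm.
\<close>

locale banach_space_over = vector_space scaleK
  for scaleK :: "'k::real_or_complex_field \<Rightarrow> 'a::banach \<Rightarrow> 'a" +
  assumes norm_scaleK: "norm (scaleK c x) = norm c * norm x"
    and scaleK_of_real: "scaleK (of_real r) x = r *\<^sub>R x"

lemma banach_space_over_real: "banach_space_over (scaleR :: real \<Rightarrow> 'a::banach \<Rightarrow> 'a)"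
  by unfold_locales (auto simp: algebra_simps)

lemma banach_space_over_complex: "banach_space_over ((*) :: complex \<Rightarrow> complex \<Rightarrow> complex)"
  by unfold_locales (auto simp: algebra_simps norm_mult scaleR_conv_of_real)


subsection \<open>Operators\<close>

definition bounded_linear_over ::
  "('k::real_normed_field \<Rightarrow> 'a::real_normed_vector \<Rightarrow> 'a) \<Rightarrow>
   ('k \<Rightarrow> 'b::real_normed_vector \<Rightarrow> 'b) \<Rightarrow> ('a \<Rightarrow> 'b) \<Rightarrow> bool" where
  "bounded_linear_over s1 s2 f \<longleftrightarrow> Vector_Spaces.linear s1 s2 f \<and> bounded_linear f"

definition dual_space ::
  "('k::real_normed_field \<Rightarrow> 'a::real_normed_vector \<Rightarrow> 'a) \<Rightarrow> ('a \<Rightarrow> 'k) set" where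
  "dual_space scaleK = {f. bounded_linear_over scaleK (*) f}"

definition rank_one ::
  "('k::real_normed_field \<Rightarrow> 'a::real_normed_vector \<Rightarrow> 'a) \<Rightarrow> ('a \<Rightarrow> 'a) \<Rightarrow> bool" where
  "rank_one scaleK R \<longleftrightarrow> vector_space.dim scaleK (range R) = 1"

definition is_maximum :: "real set \<Rightarrow> real \<Rightarrow> bool" where
  "is_maximum S m \<longleftrightarrow> m \<in> S \<and> (\<forall>s\<in>S. s \<le> m)"

text \<open>
  The equation is parametrised by the operator (semi)norm \<open>N\<close>, because it is used with
  the operator norm for linear operators and with the Lipschitz seminorm for Lipschitz maps.
\<close>

definition alternative_Daugavet_equation ::
  "(('a \<Rightarrow> 'a) \<Rightarrow> real) \<Rightarrow>
   ('k::real_normed_field \<Rightarrow> 'a::real_normed_vector \<Rightarrow> 'a) \<Rightarrow> ('a \<Rightarrow> 'a) \<Rightarrow> bool" where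
  "alternative_Daugavet_equation N scaleK T \<longleftrightarrow>
     is_maximum {N (\<lambda>x. x + scaleK \<theta> (T x)) | \<theta>. norm \<theta> = 1} (1 + N T)"

definition alternative_Daugavet_property ::
  "('k::real_normed_field \<Rightarrow> 'a::real_normed_vector \<Rightarrow> 'a) \<Rightarrow> bool" where
  "alternative_Daugavet_property scaleK \<longleftrightarrow>
     (\<forall>R. bounded_linear_over scaleK scaleK R \<and> rank_one scaleK R \<longrightarrow>
        alternative_Daugavet_equation onorm scaleK R)"

definition Lip :: "('a::real_normed_vector \<Rightarrow> 'a) set" where
  "Lip = {T. \<exists>L. L-lipschitz_on UNIV T}"

definition lip_norm :: "('a::real_normed_vector \<Rightarrow> 'a) \<Rightarrow> real" where
  "lip_norm T = Sup {norm (T x1 - T x2) / norm (x1 - x2) | x1 x2. x1 \<noteq> x2}"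

definition slope :: "('a::real_normed_vector \<Rightarrow> 'a) \<Rightarrow> 'a set" where
  "slope T = {(T x1 - T x2) /\<^sub>R norm (x1 - x2) | x1 x2. x1 \<noteq> x2}"


subsection \<open>Properties of a closed bounded convex set\<close>

text \<open>
  Open half-spaces are given by nonzero real-valued real-linear bounded functionals;
  over the complex numbers these are exactly the real parts of the nonzero elements of the dual.
\<close>

definition slice_of :: "'a::real_normed_vector set \<Rightarrow> 'a set \<Rightarrow> bool" where
  "slice_of D S \<longleftrightarrow> S \<noteq> {} \<and>
     (\<exists>(f :: 'a \<Rightarrow> real) a. bounded_linear f \<and> f \<noteq> (\<lambda>_. 0) \<and> S = D \<inter> {x. f x > a})"

definition dentable :: "'a::real_normed_vector set \<Rightarrow> bool" where
  "dentable D \<longleftrightarrow> (\<forall>\<epsilon>>0. \<exists>S. slice_of D S \<and> diameter S < \<epsilon>)"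

definition Radon_Nikodym_property :: "'a::real_normed_vector set \<Rightarrow> bool" where
  "Radon_Nikodym_property C \<longleftrightarrow>
     (\<forall>D\<subseteq>C. D \<noteq> {} \<and> closed D \<and> convex D \<longrightarrow> dentable D)"

text \<open>
  Inserting 0 only matters for empty \<open>B\<close>, where the real-valued \<open>Sup\<close> is unspecified.
\<close>

definition sup_seminorm :: "'a set \<Rightarrow> ('a \<Rightarrow> 'k::real_normed_vector) \<Rightarrow> real" where
  "sup_seminorm B f = Sup (insert 0 ((\<lambda>b. norm (f b)) ` B))"

definition Asplund_property ::
  "('k::real_normed_field \<Rightarrow> 'a::real_normed_vector \<Rightarrow> 'a) \<Rightarrow> 'a set \<Rightarrow> bool" where
  "Asplund_property scaleK C \<longleftrightarrow>
     (\<forall>B\<subseteq>C. countable B \<longrightarrow>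
        (\<exists>Q\<subseteq>dual_space scaleK. countable Q \<and>
           (\<forall>f\<in>dual_space scaleK. \<forall>\<epsilon>>0. \<exists>q\<in>Q. sup_seminorm B (\<lambda>x. f x - q x) < \<epsilon>)))"

definition weak_topology ::
  "('k::real_normed_field \<Rightarrow> 'a::real_normed_vector \<Rightarrow> 'a) \<Rightarrow> 'a topology" where
  "weak_topology scaleK =
     topology_generated_by {f -` U | f U. f \<in> dual_space scaleK \<and> open U}"

definition convex_point_of_continuity_property ::
  "('k::real_normed_field \<Rightarrow> 'a::real_normed_vector \<Rightarrow> 'a) \<Rightarrow> 'a set \<Rightarrow> bool" where
  "convex_point_of_continuity_property scaleK C \<longleftrightarrow>
     (\<forall>D\<subseteq>C. D \<noteq> {} \<and> closed D \<and> convex D \<longrightarrow>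
        (\<exists>x\<in>D. topcontinuous_at (subtopology (weak_topology scaleK) D) (top_of_set D) id x))"

definition equivalent_to_l1_basis ::
  "('k::real_normed_field \<Rightarrow> 'a::real_normed_vector \<Rightarrow> 'a) \<Rightarrow> (nat \<Rightarrow> 'a) \<Rightarrow> bool" where
  "equivalent_to_l1_basis scaleK x \<longleftrightarrow>
     (\<exists>m>0. \<exists>M>0. \<forall>(a :: nat \<Rightarrow> 'k) n.
        m * (\<Sum>i<n. norm (a i)) \<le> norm (\<Sum>i<n. scaleK (a i) (x i)) \<and>
        norm (\<Sum>i<n. scaleK (a i) (x i)) \<le> M * (\<Sum>i<n. norm (a i)))"

definition no_l1_sequences ::
  "('k::real_normed_field \<Rightarrow> 'a::real_normed_vector \<Rightarrow> 'a) \<Rightarrow> 'a set \<Rightarrow> bool" where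
  "no_l1_sequences scaleK C \<longleftrightarrow> \<not> (\<exists>x. range x \<subseteq> C \<and> equivalent_to_l1_basis scaleK x)"

end

theory Submission
  imports Defs
begin

text \<open>
  Idea. Fix \<open>e\<close> of norm close to \<open>lip_norm T\<close> in the convex hull \<open>C\<close> of the slopes, and play the following
  game. The positions are sums \<open>v = e + \<theta>\<^sub>1 y\<^sub>1 + \<dots> + \<theta>\<^sub>n y\<^sub>n\<close> of almost maximal norm, where \<open>y\<^sub>i\<close> is the direction
  of a pair of points with slope \<open>t\<^sub>i\<close>. By the alternative Daugavet property, the unit vectors \<open>y\<close> that
  prolong a position have the unit ball as closed convex hull; splitting the segment between two points
  into steps in such directions shows that the slopes of the prolonging pairs have \<open>C\<close> as closed convex
  hull. So every slice of \<open>C\<close> contains a legal next slope. If the \<open>t\<^sub>i\<close> can be steered so that a convex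
  combination of them approximates \<open>e\<close>, then a functional norming \<open>v\<close> is almost \<open>\<parallel>e\<parallel>\<close> at some \<open>t\<^sub>i\<close> and almost \<open>1\<close>
  at \<open>\<theta>\<^sub>i y\<^sub>i\<close>, so that \<open>\<parallel>\<theta>\<^sub>i y\<^sub>i + t\<^sub>i\<parallel>\<close> is almost \<open>1 + lip_norm T\<close>.

  Steering makes the averages of the \<open>t\<^sub>i\<close> dense in \<open>C\<close> for the topology of any prescribed countable set \<open>Q\<close>
  of functionals. It therefore suffices to find \<open>Q\<close> such that no functional of norm at most one
  separates \<open>e\<close> by \<open>\<epsilon>\<close> from a \<open>Q\<close>-dense set. For the Asplund property, \<open>Q\<close> is dense for the seminorm; for RNP
  and CPCP a finite \<open>Q\<close> isolates a small piece of \<open>C\<close>. If no such \<open>Q\<close> exists, the separating functionals form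
  a set that is not small for a suitable \<open>\<sigma>\<close>-ideal, and a Cantor scheme of non-small sets yields an
  \<open>l\<^sub>1\<close>-sequence in \<open>C\<close>.
\<close>

section \<open>The Hahn-Banach theorem\<close>

definition sublinear :: "('a::real_vector \<Rightarrow> real) \<Rightarrow> bool" where
  "sublinear p \<longleftrightarrow> (\<forall>x y. p (x + y) \<le> p x + p y) \<and> (\<forall>c>0. \<forall>x. p (c *\<^sub>R x) = c * p x)"

lemma sublinear_add: "sublinear p \<Longrightarrow> p (x + y) \<le> p x + p y"
  and sublinear_scale: "sublinear p \<Longrightarrow> c > 0 \<Longrightarrow> p (c *\<^sub>R x) = c * p x"
  by (auto simp: sublinear_def)

lemma sublinear_zero: "sublinear p \<Longrightarrow> p 0 = 0"
  using sublinear_scale[of p 2 0] by simp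

lemma sublinear_minus: "sublinear p \<Longrightarrow> - p (- x) \<le> p x"
  using sublinear_add[of p x "- x"] sublinear_zero[of p] by simp

text \<open>One inequality of positive homogeneity suffices: used for \<open>1/c\<close> at
  \<open>c *\<^sub>R x\<close> it yields the other.\<close>

lemma sublinearI:
  assumes add: "\<And>x y. p (x + y) \<le> p x + p y" and scale: "\<And>c x. c > 0 \<Longrightarrow> p (c *\<^sub>R x) \<le> c * p x"
  shows "sublinear p"
  unfolding sublinear_def
proof (intro conjI allI impI)
  fix c :: real and x assume c: "c > 0"
  have "p ((1/c) *\<^sub>R (c *\<^sub>R x)) \<le> (1/c) * p (c *\<^sub>R x)"
    using c by (intro scale) auto
  then have "c * p x \<le> p (c *\<^sub>R x)"
    using c by (simp add: field_simps)
  then show "p (c *\<^sub>R x) = c * p x"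
    using scale[OF c, of x] by simp
qed (rule add)

text \<open>Zorn's lemma for the reversed order. The pointwise infimum of a chain is a lower bound;
  it is finite because every sublinear \<open>q \<le> p\<close> satisfies
  \<open>- p (- x) \<le> q x\<close>.\<close>

lemma minimal_sublinear_below:
  assumes p: "sublinear p"
  obtains q where "sublinear q" "q \<le> p" "\<And>r. sublinear r \<Longrightarrow> r \<le> q \<Longrightarrow> r = q"
proof -
  let ?A = "{q. sublinear q \<and> q \<le> p}"
  have "\<exists>m\<in>?A. \<forall>a\<in>?A. a \<le> m \<longrightarrow> a = m"
  proof (rule predicate_Zorn[where P = "\<lambda>a b. b \<le> a"])
    show "partial_order_on ?A (relation_of (\<lambda>a b. b \<le> a) ?A)"
      by (rule partial_order_on_relation_ofI) auto
  next
    fix C assume C: "C \<in> Chains (relation_of (\<lambda>a b. b \<le> a) ?A)"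
    then have CA: "C \<subseteq> ?A" and chain: "a \<le> b \<or> b \<le> a" if "a \<in> C" "b \<in> C" for a b
      using that by (auto simp: Chains_def relation_of_def)
    show "\<exists>u\<in>?A. \<forall>a\<in>C. u \<le> a"
    proof (cases "C = {}")
      case True
      then show ?thesis using p by auto
    next
      case False
      define u where "u x = (INF q\<in>C. q x)" for x
      have bdd: "bdd_below ((\<lambda>q. q x) ` C)" for x
      proof (rule bdd_belowI2[where m = "- p (- x)"])
        fix q assume "q \<in> C"
        then have "sublinear q" "q \<le> p" using CA by auto
        then show "- p (- x) \<le> q x"
          using sublinear_minus[of q x] by (smt (verit) le_funD)
      qed
      have le: "u x \<le> q x" if "q \<in> C" for q x
        unfolding u_def using bdd that by (rule cINF_lower)
      have "sublinear u"
      proof (rule sublinearI)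
        fix x y
        \<comment> \<open>Two members of the chain may realise the two infima; the smaller of them
          serves for both.\<close>
        have "u (x + y) \<le> q1 x + q2 y" if q: "q1 \<in> C" "q2 \<in> C" for q1 q2
        proof -
          obtain q where "q \<in> C" "q \<le> q1" "q \<le> q2" using chain[OF q] q by auto
          then show ?thesis
            using le[of q "x + y"] sublinear_add[of q x y] CA
            by (smt (verit) le_funD mem_Collect_eq subsetD)
        qed
        then have "u (x + y) - q2 y \<le> u x" if "q2 \<in> C" for q2
          unfolding u_def[of x] using that False by (intro cINF_greatest) (auto simp: algebra_simps)
        then have "u (x + y) - u x \<le> q2 y" if "q2 \<in> C" for q2
          using that by (smt (verit))
        then have "u (x + y) - u x \<le> u y"
          unfolding u_def[of y] using False by (intro cINF_greatest) auto
        then show "u (x + y) \<le> u x + u y" by simp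
      next
        fix c :: real and x assume c: "c > 0"
        have "u (c *\<^sub>R x) / c \<le> q x" if "q \<in> C" for q
        proof -
          have "sublinear q" using CA that by auto
          then show ?thesis
            using le[OF that, of "c *\<^sub>R x"] sublinear_scale[of q c x] c by (simp add: field_simps)
        qed
        then have "u (c *\<^sub>R x) / c \<le> u x"
          unfolding u_def[of x] using False by (intro cINF_greatest) auto
        then show "u (c *\<^sub>R x) \<le> c * u x" using c by (simp add: field_simps)
      qed
      moreover have "u \<le> p"
      proof (rule le_funI)
        fix x
        obtain q where "q \<in> C" using False by auto
        then show "u x \<le> p x" using le[of q x] CA by (smt (verit) le_funD mem_Collect_eq subsetD)
      qed
      ultimately show ?thesis using le by (auto simp: le_fun_def)
    qed
  qed
  then show ?thesis
    by (smt (verit) mem_Collect_eq order_trans that)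
qed

text \<open>A minimal sublinear functional is already linear, so the functional comes from
  minimality and not from an extension off a subspace.\<close>

theorem Hahn_Banach_sublinear:
  fixes p :: "'a::real_vector \<Rightarrow> real"
  assumes "sublinear p"
  obtains f where "linear f" "\<And>x. f x \<le> p x"
proof -
  obtain q where q: "sublinear q" "q \<le> p" and min: "\<And>r. sublinear r \<Longrightarrow> r \<le> q \<Longrightarrow> r = q"
    using minimal_sublinear_below[OF assms] by blast
  \<comment> \<open>Lowering \<open>q\<close> in the direction \<open>y\<close> cannot change it, which forces additivity.\<close>
  have add: "q (x + y) = q x + q y" for x y
  proof -
    define r where "r x = (INF t\<in>{0..}. q (x + t *\<^sub>R y) - t * q y)" for x
    have lb: "- q (- x) \<le> q (x + t *\<^sub>R y) - t * q y" if "t \<ge> 0" for x t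
    proof (cases "t = 0")
      case True
      then show ?thesis using sublinear_minus[OF q(1), of x] by simp
    next
      case False
      then have "q (t *\<^sub>R y) = t * q y" using that sublinear_scale[OF q(1)] by simp
      then show ?thesis using sublinear_add[OF q(1), of "x + t *\<^sub>R y" "- x"] by simp
    qed
    then have bdd: "bdd_below ((\<lambda>t. q (x + t *\<^sub>R y) - t * q y) ` {0..})" for x
      by (intro bdd_belowI2) auto
    have le: "r x \<le> q (x + t *\<^sub>R y) - t * q y" if "t \<ge> 0" for x t
      unfolding r_def using bdd that by (intro cINF_lower) auto
    have "sublinear r"
    proof (rule sublinearI)
      fix x z
      have "r (x + z) \<le> (q (x + t *\<^sub>R y) - t * q y) + (q (z + s *\<^sub>R y) - s * q y)"
        if "t \<ge> 0" "s \<ge> 0" for t s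
        using le[of "t + s" "x + z"] that sublinear_add[OF q(1), of "x + t *\<^sub>R y" "z + s *\<^sub>R y"]
        by (simp add: algebra_simps)
      then have "r (x + z) - (q (z + s *\<^sub>R y) - s * q y) \<le> r x" if "s \<ge> 0" for s
        unfolding r_def[of x] using that by (intro cINF_greatest) (auto simp: algebra_simps)
      then have "r (x + z) - r x \<le> q (z + s *\<^sub>R y) - s * q y" if "s \<ge> 0" for s
        using that by (smt (verit))
      then have "r (x + z) - r x \<le> r z"
        unfolding r_def[of z] by (intro cINF_greatest) auto
      then show "r (x + z) \<le> r x + r z" by simp
    next
      fix c :: real and x assume c: "c > 0"
      have "r (c *\<^sub>R x) / c \<le> q (x + t *\<^sub>R y) - t * q y" if "t \<ge> 0" for t
      proof -
        have "r (c *\<^sub>R x) \<le> q (c *\<^sub>R (x + t *\<^sub>R y)) - (c * t) * q y"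
          using le[of "c * t" "c *\<^sub>R x"] that c by (simp add: algebra_simps)
        then show ?thesis
          using sublinear_scale[OF q(1) c, of "x + t *\<^sub>R y"] c by (simp add: field_simps)
      qed
      then have "r (c *\<^sub>R x) / c \<le> r x"
        unfolding r_def[of x] by (intro cINF_greatest) auto
      then show "r (c *\<^sub>R x) \<le> c * r x" using c by (simp add: field_simps)
    qed
    moreover have "r \<le> q"
      using le[of 0] by (simp add: le_fun_def)
    ultimately have "r = q" by (rule min)
    \<comment> \<open>The value \<open>t = 1\<close> in the infimum \<open>r x\<close> gives
      \<open>q x + q y \<le> q (x + y)\<close>.\<close>
    then show ?thesis
      using le[of 1 x] sublinear_add[OF q(1), of x y] by simp
  qed
  have neg: "q (- x) = - q x" for x
    using add[of x "- x"] sublinear_zero[OF q(1)] by simp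
  have "q (c *\<^sub>R x) = c * q x" for c x
  proof (cases c "0::real" rule: linorder_cases)
    case less
    then have "q ((- c) *\<^sub>R x) = (- c) * q x" by (intro sublinear_scale[OF q(1)]) simp
    then show ?thesis using neg[of "c *\<^sub>R x"] by simp
  qed (use sublinear_scale[OF q(1)] sublinear_zero[OF q(1)] in auto)
  then have "linear q" by (intro linearI) (auto simp: add)
  then show ?thesis using that q(2) by (auto simp: le_fun_def)
qed

text \<open>The real functionals of norm at most one, zero included. By linearity the one-sided
  bound also controls the absolute value.\<close>

definition unit_functional :: "('a::real_normed_vector \<Rightarrow> real) \<Rightarrow> bool" where
  "unit_functional f \<longleftrightarrow> linear f \<and> (\<forall>x. f x \<le> norm x)"

lemma unit_functional_abs_le:
  assumes "unit_functional f"
  shows "\<bar>f x\<bar> \<le> norm x"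
proof -
  have "f (- x) = - f x" "f x \<le> norm x"
    using assms linear_neg[of f x] by (auto simp: unit_functional_def)
  moreover have "f (- x) \<le> norm (- x)"
    using assms unfolding unit_functional_def by blast
  ultimately show ?thesis by simp
qed

lemma unit_functional_bounded_linear: "unit_functional f \<Longrightarrow> bounded_linear f"
  by (rule bounded_linear_intro[where K = 1])
    (use unit_functional_abs_le in \<open>auto simp: unit_functional_def linear_iff\<close>)

text \<open>The separating functional is dominated by the largest sublinear \<open>p \<le> norm\<close> with \<open>p (s - e) \<le> - \<epsilon>\<close>
  on \<open>S\<close>.\<close>

theorem Hahn_Banach_separation:
  fixes S :: "'a::real_normed_vector set"
  assumes S: "convex S" "S \<noteq> {}" and dist: "\<And>s. s \<in> S \<Longrightarrow> norm (e - s) \<ge> \<epsilon>"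
  obtains f where "unit_functional f" "\<And>s. s \<in> S \<Longrightarrow> f e \<ge> f s + \<epsilon>"
proof -
  define h where "h x = (\<lambda>(t, s). norm (x - t *\<^sub>R (s - e)) - t * \<epsilon>)" for x
  let ?I = "{0::real..} \<times> S"
  define p where "p x = (INF i\<in>?I. h x i)" for x
  have ne: "?I \<noteq> {}" using S by auto
  have "- norm x \<le> h x i" if I: "i \<in> ?I" for x i
  proof -
    obtain t s where i: "i = (t, s)" "t \<ge> 0" "s \<in> S" using I by (cases i) auto
    have "t * \<epsilon> \<le> norm (t *\<^sub>R (s - e))"
      using dist[OF i(3)] i(2) by (simp add: mult_left_mono norm_minus_commute)
    also have "\<dots> \<le> norm (x - t *\<^sub>R (s - e)) + norm x"
      using norm_triangle_ineq4[of x "x - t *\<^sub>R (s - e)"] by simp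
    finally show ?thesis by (simp add: h_def i)
  qed
  then have bdd: "bdd_below (h x ` ?I)" for x
    by (intro bdd_belowI2) auto
  have le: "p x \<le> h x i" if "i \<in> ?I" for x i
    unfolding p_def using bdd that by (rule cINF_lower)
  have "sublinear p"
  proof (rule sublinearI)
    fix x y
    have *: "p (x + y) \<le> h x i + h y j" if ij: "i \<in> ?I" "j \<in> ?I" for i j
    proof -
      obtain t s t' s' where i: "i = (t, s)" "t \<ge> 0" "s \<in> S" and j: "j = (t', s')" "t' \<ge> 0" "s' \<in> S"
        using ij by (cases i; cases j) auto
      \<comment> \<open>Convexity merges two steps of lengths \<open>t\<close> and \<open>t'\<close>
        into one step of length \<open>t + t'\<close>, which gives subadditivity of
        \<open>p\<close>.\<close>
      obtain r where r: "r \<in> S" "(t + t') *\<^sub>R (r - e) = t *\<^sub>R (s - e) + t' *\<^sub>R (s' - e)"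
      proof (cases "t + t' = 0")
        case True
        then have "t = 0" "t' = 0" using i j by auto
        then show ?thesis using that[OF i(3)] by simp
      next
        case False
        define r where "r = (t / (t + t')) *\<^sub>R s + (t' / (t + t')) *\<^sub>R s'"
        have "r \<in> S" unfolding r_def
          using i j False by (intro convexD[OF S(1)]) (auto simp: add_divide_distrib[symmetric])
        moreover have "(t + t') *\<^sub>R r = t *\<^sub>R s + t' *\<^sub>R s'"
          using False by (simp add: r_def scaleR_add_right)
        ultimately show ?thesis using that by (simp add: algebra_simps)
      qed
      have "p (x + y) \<le> h (x + y) (t + t', r)" using i j r by (intro le) auto
      also have "\<dots> = norm ((x - t *\<^sub>R (s - e)) + (y - t' *\<^sub>R (s' - e))) - (t + t') * \<epsilon>"
        unfolding h_def prod.case r(2) by (simp add: algebra_simps)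
      also have "\<dots> \<le> h x i + h y j"
        unfolding h_def i j prod.case
        using norm_triangle_ineq[of "x - t *\<^sub>R (s - e)" "y - t' *\<^sub>R (s' - e)"]
        by (simp add: algebra_simps)
      finally show ?thesis .
    qed
    have "p (x + y) - h y j \<le> p x" if "j \<in> ?I" for j
      unfolding p_def[of x] using * that ne by (intro cINF_greatest) (auto simp: algebra_simps)
    then have "p (x + y) - p x \<le> p y"
      unfolding p_def[of y] using ne by (intro cINF_greatest) (auto simp: algebra_simps)
    then show "p (x + y) \<le> p x + p y" by simp
  next
    fix c :: real and x assume c: "c > 0"
    have "p (c *\<^sub>R x) / c \<le> h x i" if I: "i \<in> ?I" for i
    proof -
      obtain t s where i: "i = (t, s)" "t \<ge> 0" "s \<in> S" using I by (cases i) auto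
      have "p (c *\<^sub>R x) \<le> h (c *\<^sub>R x) (c * t, s)" using i c by (intro le) auto
      also have "\<dots> = norm (c *\<^sub>R (x - t *\<^sub>R (s - e))) - c * t * \<epsilon>"
        by (simp add: h_def algebra_simps)
      also have "\<dots> = c * h x i"
        unfolding norm_scaleR h_def i prod.case using c by (simp add: right_diff_distrib)
      finally show ?thesis using c by (simp add: field_simps)
    qed
    then have "p (c *\<^sub>R x) / c \<le> p x"
      unfolding p_def[of x] using ne by (intro cINF_greatest) auto
    then show "p (c *\<^sub>R x) \<le> c * p x" using c by (simp add: field_simps)
  qed
  then obtain f where f: "linear f" "\<And>x. f x \<le> p x" using Hahn_Banach_sublinear by blast
  show ?thesis
  proof
    obtain s where "s \<in> S" using S by auto
    have "f x \<le> norm x" for x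
      using f(2)[of x] le[of "(0, s)" x] \<open>s \<in> S\<close> by (simp add: h_def)
    then show "unit_functional f" using f(1) by (simp add: unit_functional_def)
  next
    fix s assume "s \<in> S"
    then have "f (s - e) \<le> - \<epsilon>"
      using f(2)[of "s - e"] le[of "(1, s)" "s - e"] by (simp add: h_def)
    then show "f e \<ge> f s + \<epsilon>" using f(1) by (simp add: linear_diff)
  qed
qed

text \<open>Separate \<open>x\<close> from \<open>{0}\<close> at distance
  \<open>norm x\<close>.\<close>

corollary norming_functional:
  fixes x :: "'a::real_normed_vector"
  obtains f where "unit_functional f" "f x = norm x"
proof -
  obtain f where f: "unit_functional f" "\<And>s. s \<in> {0} \<Longrightarrow> f x \<ge> f s + norm x"
    using Hahn_Banach_separation[of "{0}" "norm x" x] by auto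
  have "f 0 = 0" using f(1) by (simp add: unit_functional_def linear_0)
  then have "f x = norm x" using f by (simp add: unit_functional_def order_antisym)
  then show ?thesis using that f(1) by blast
qed

corollary closure_convex_separation:
  fixes S :: "'a::real_normed_vector set"
  assumes "convex S" "S \<noteq> {}" "e \<notin> closure S"
  obtains f \<epsilon> where "unit_functional f" "\<epsilon> > 0" "\<And>s. s \<in> S \<Longrightarrow> f e \<ge> f s + \<epsilon>"
proof -
  obtain \<epsilon> where "\<epsilon> > 0" "\<And>s. s \<in> S \<Longrightarrow> dist s e \<ge> \<epsilon>"
    using assms(3) by (auto simp: closure_approachable not_less)
  then show ?thesis
    using Hahn_Banach_separation[OF assms(1,2), of \<epsilon> e] that
    by (metis dist_commute dist_norm)
qed

section \<open>Sequences equivalent to the basis of l1\<close>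

text \<open>Real and complex scalars are treated together as a subfield of the complex numbers. Only
  ring structure and norm are transported; compatibility with real scalars is derived below.\<close>

locale embedded_banach_space = banach_space_over scaleK
  for scaleK :: "'k::real_or_complex_field \<Rightarrow> 'a::banach \<Rightarrow> 'a" +
  fixes emb :: "'k \<Rightarrow> complex"
  assumes emb_add: "emb (x + y) = emb x + emb y"
    and emb_mult: "emb (x * y) = emb x * emb y"
    and norm_emb: "norm (emb x) = norm x"
    and range_emb: "range emb = UNIV \<or> range emb = \<real>"
begin

lemma emb_zero: "emb 0 = 0"
  using norm_emb[of 0] by simp

lemma emb_diff: "emb (x - y) = emb x - emb y"
  using emb_add[of "x - y" y] by simp

lemma emb_sum: "emb (sum f A) = (\<Sum>a\<in>A. emb (f a))"
  by (induction A rule: infinite_finite_induct) (auto simp: emb_zero emb_add)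

lemma emb_one: "emb 1 = 1"
proof -
  have "emb 1 * emb 1 = emb 1" "emb 1 \<noteq> 0"
    using emb_mult[of 1 1] norm_emb[of 1] by auto
  then show ?thesis by simp
qed

text \<open>A complex number is determined as the real \<open>r\<close> by its distances to
  \<open>1\<close>, \<open>- 1\<close> and \<open>0\<close>: the first two fix the real part, and
  the third then makes the imaginary part vanish.\<close>

lemma emb_of_real: "emb (of_real r) = of_real r"
proof -
  let ?z = "emb (of_real r)"
  have "norm (?z - 1) = norm (of_real r - 1 :: 'k)" "norm (?z + 1) = norm (of_real r + 1 :: 'k)"
    by (metis emb_diff emb_one norm_emb) (metis emb_add emb_one norm_emb)
  then have "norm (?z - 1) = \<bar>r - 1\<bar>" "norm (?z + 1) = \<bar>r + 1\<bar>"
    by (metis norm_of_real of_real_1 of_real_diff) (metis norm_of_real of_real_1 of_real_add \<open>norm (?z + 1) = norm (of_real r + 1 :: 'k)\<close>)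
  then have "(norm (?z - 1))\<^sup>2 = (r - 1)\<^sup>2" "(norm (?z + 1))\<^sup>2 = (r + 1)\<^sup>2" "(norm ?z)\<^sup>2 = r\<^sup>2"
    by (simp_all add: norm_emb)
  then have sq: "(Re ?z - 1)\<^sup>2 + (Im ?z)\<^sup>2 = (r - 1)\<^sup>2" "(Re ?z + 1)\<^sup>2 + (Im ?z)\<^sup>2 = (r + 1)\<^sup>2"
    "(Re ?z)\<^sup>2 + (Im ?z)\<^sup>2 = r\<^sup>2"
    by (simp_all only: cmod_power2 minus_complex.simps plus_complex.simps one_complex.simps) auto
  then have "Re ?z = r"
    by (simp add: power2_eq_square algebra_simps)
  with sq(3) have "Re ?z = r" "Im ?z = 0"
    by auto
  then show ?thesis by (simp add: complex_eq_iff)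
qed

lemma emb_scaleR: "emb (r *\<^sub>R c) = r *\<^sub>R emb c"
  by (simp add: scaleR_conv_of_real emb_mult emb_of_real)

definition dual_ball :: "('a \<Rightarrow> 'k) set" where
  "dual_ball = {g \<in> dual_space scaleK. \<forall>x. norm (g x) \<le> norm x}"

lemma dual_space_add: "g \<in> dual_space scaleK \<Longrightarrow> g (x + y) = g x + g y"
  and dual_space_scale: "g \<in> dual_space scaleK \<Longrightarrow> g (scaleK c x) = c * g x"
  and dual_space_bounded_linear: "g \<in> dual_space scaleK \<Longrightarrow> bounded_linear g"
  by (auto simp: dual_space_def bounded_linear_over_def Vector_Spaces.linear_def
      module_hom.add module_hom.scale)

lemma dual_space_diff: "g \<in> dual_space scaleK \<Longrightarrow> g (x - y) = g x - g y"
  using dual_space_add[of g "x - y" y] by simp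

lemma dual_space_sum: "g \<in> dual_space scaleK \<Longrightarrow> g (sum f A) = (\<Sum>a\<in>A. g (f a))"
  using dual_space_diff[of g 0 0]
  by (induction A rule: infinite_finite_induct) (auto simp: dual_space_add)

definition re :: "('a \<Rightarrow> 'k) \<Rightarrow> 'a \<Rightarrow> real" where "re g x = Re (emb (g x))"
definition im :: "('a \<Rightarrow> 'k) \<Rightarrow> 'a \<Rightarrow> real" where "im g x = Im (emb (g x))"

lemma bounded_linear_emb: "bounded_linear emb"
  by (rule bounded_linear_intro[where K = 1]) (auto simp: emb_add emb_scaleR norm_emb)

lemma re_bounded_linear: "g \<in> dual_space scaleK \<Longrightarrow> bounded_linear (re g)"
  and im_bounded_linear: "g \<in> dual_space scaleK \<Longrightarrow> bounded_linear (im g)"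
  unfolding re_def im_def
  by (intro bounded_linear_compose[OF bounded_linear_Re] bounded_linear_compose[OF bounded_linear_Im]
      bounded_linear_compose[OF bounded_linear_emb] dual_space_bounded_linear; assumption)+

text \<open>As in Rosenthal's argument, two functionals with complementary patterns differ at
  \<open>d i\<close> by nearly \<open>z - w\<close>, with a sign that can be matched to the
  coefficient. This bounds the norm of the combination from below.\<close>

lemma independent_imp_l1_basis:
  assumes bdd: "\<And>i. norm (d i) \<le> R"
    and gap: "4 * \<eta> < norm (z - w)"
    and ind: "\<And>n S. \<exists>g\<in>dual_ball. \<forall>i<n. norm (emb (g (d i)) - (if i \<in> S then z else w)) < \<eta>"
  shows "equivalent_to_l1_basis scaleK d"
proof -
  define \<gamma> where "\<gamma> = z - w"
  have lower: "(norm \<gamma> - 4 * \<eta>) / 4 * (\<Sum>i<n. norm (a i)) \<le> norm (\<Sum>i<n. scaleK (a i) (d i))"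
    for a :: "nat \<Rightarrow> 'k" and n
  proof -
    define x where "x = (\<Sum>i<n. scaleK (a i) (d i))"
    \<comment> \<open>The rotation \<open>\<zeta>\<close> acts on values in the complex plane, so
      \<open>\<zeta> = \<i>\<close> is admissible even when the scalars are real.\<close>
    have main: "(\<Sum>i<n. \<bar>Re (\<zeta> * emb (a i) * \<gamma>)\<bar>) - 2 * \<eta> * (\<Sum>i<n. norm (a i)) \<le> 2 * norm x"
      if \<zeta>: "norm \<zeta> = 1" for \<zeta>
    proof -
      define S where "S = {i. Re (\<zeta> * emb (a i) * \<gamma>) \<ge> 0}"
      obtain g where g: "g \<in> dual_ball"
        "\<And>i. i < n \<Longrightarrow> norm (emb (g (d i)) - (if i \<in> S then z else w)) < \<eta>"
        using ind[of n S] by auto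
      obtain h where h: "h \<in> dual_ball"
        "\<And>i. i < n \<Longrightarrow> norm (emb (h (d i)) - (if i \<in> - S then z else w)) < \<eta>"
        using ind[of n "- S"] by auto
      have ev: "emb (k x) = (\<Sum>i<n. emb (a i) * emb (k (d i)))" if "k \<in> dual_ball" for k
        using that unfolding x_def
        by (simp add: dual_ball_def dual_space_sum dual_space_scale emb_sum emb_mult)
      have "\<bar>Re (\<zeta> * emb (a i) * \<gamma>)\<bar> - 2 * \<eta> * norm (a i)
          \<le> Re (\<zeta> * emb (a i) * (emb (g (d i)) - emb (h (d i))))" if i: "i < n" for i
      proof -
        define s where "s = (if i \<in> S then \<gamma> else - \<gamma>)"
        define err where "err = emb (g (d i)) - emb (h (d i)) - s"
        have "err = (emb (g (d i)) - (if i \<in> S then z else w)) - (emb (h (d i)) - (if i \<in> - S then z else w))"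
          by (simp add: err_def s_def \<gamma>_def)
        then have "norm err \<le> 2 * \<eta>"
          using g(2)[OF i] h(2)[OF i] norm_triangle_ineq4 by (smt (verit))
        then have "norm (\<zeta> * emb (a i) * err) \<le> norm (a i) * (2 * \<eta>)"
          using \<zeta> by (simp add: norm_mult norm_emb mult_left_mono)
        then have "- (2 * \<eta> * norm (a i)) \<le> Re (\<zeta> * emb (a i) * err)"
          using abs_Re_le_cmod[of "\<zeta> * emb (a i) * err"] by (simp add: mult.commute)
        moreover have "Re (\<zeta> * emb (a i) * s) = \<bar>Re (\<zeta> * emb (a i) * \<gamma>)\<bar>"
          by (auto simp: s_def S_def)
        moreover have "emb (g (d i)) - emb (h (d i)) = s + err"
          by (simp add: err_def)
        ultimately show ?thesis by (simp only: distrib_left plus_complex.simps)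
      qed
      then have "(\<Sum>i<n. \<bar>Re (\<zeta> * emb (a i) * \<gamma>)\<bar> - 2 * \<eta> * norm (a i))
          \<le> (\<Sum>i<n. Re (\<zeta> * emb (a i) * (emb (g (d i)) - emb (h (d i)))))"
        by (intro sum_mono) simp
      also have "\<dots> = Re (\<zeta> * (emb (g x) - emb (h x)))"
        by (simp only: ev[OF g(1)] ev[OF h(1)] sum_subtractf[symmetric] sum_distrib_left Re_sum
            right_diff_distrib mult.assoc)
      also have "\<dots> \<le> norm (\<zeta> * (emb (g x) - emb (h x)))"
        by (rule complex_Re_le_cmod)
      also have "\<dots> \<le> norm (emb (g x)) + norm (emb (h x))"
        using \<zeta> by (simp add: norm_mult norm_triangle_ineq4)
      also have "\<dots> \<le> 2 * norm x"
        using g(1) h(1) by (smt (verit) dual_ball_def mem_Collect_eq norm_emb)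
      finally show ?thesis by (simp add: sum_subtractf sum_distrib_left)
    qed
    \<comment> \<open>The modulus is at most the sum of the real and imaginary parts in absolute
      value, which are \<open>main\<close> for \<open>1\<close> and for \<open>\<i>\<close>.\<close>
    have "norm \<gamma> * (\<Sum>i<n. norm (a i)) = (\<Sum>i<n. norm (emb (a i) * \<gamma>))"
      by (simp add: norm_mult norm_emb sum_distrib_left mult.commute)
    also have "\<dots> \<le> (\<Sum>i<n. \<bar>Re (1 * emb (a i) * \<gamma>)\<bar> + \<bar>Re (\<i> * emb (a i) * \<gamma>)\<bar>)"
    proof (rule sum_mono)
      fix i
      show "norm (emb (a i) * \<gamma>) \<le> \<bar>Re (1 * emb (a i) * \<gamma>)\<bar> + \<bar>Re (\<i> * emb (a i) * \<gamma>)\<bar>"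
        using cmod_le[of "emb (a i) * \<gamma>"] by (simp only: mult.assoc Re_i_times) simp
    qed
    also have "\<dots> \<le> 4 * norm x + 4 * \<eta> * (\<Sum>i<n. norm (a i))"
      using main[of 1] main[of \<i>] by (simp add: sum.distrib)
    finally show ?thesis by (simp add: x_def field_simps)
  qed
  have upper: "norm (\<Sum>i<n. scaleK (a i) (d i)) \<le> (\<bar>R\<bar> + 1) * (\<Sum>i<n. norm (a i))"
    for a :: "nat \<Rightarrow> 'k" and n
  proof -
    have "norm (scaleK (a i) (d i)) \<le> (\<bar>R\<bar> + 1) * norm (a i)" for i
      using bdd[of i] by (simp add: norm_scaleK mult.commute[of "norm (a i)"] mult_right_mono)
    then show ?thesis
      unfolding sum_distrib_left by (intro sum_norm_le)
  qed
  show ?thesis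
    unfolding equivalent_to_l1_basis_def
    using gap lower upper
    by (intro exI[of _ "(norm \<gamma> - 4 * \<eta>) / 4"] exI[of _ "\<bar>R\<bar> + 1"] conjI allI) (auto simp: \<gamma>_def)
qed

end

section \<open>The ideal of small sets of functionals and the Cantor scheme\<close>

text \<open>Density of the low part \<open>{a\<in>D. f a \<le> f e - \<epsilon>}\<close> in
  \<open>D\<close> for the topology induced by \<open>Q\<close>, expressed through basic
  neighbourhoods.\<close>

definition separates_dense ::
  "('a \<Rightarrow> real) \<Rightarrow> ('a \<Rightarrow> real) set \<Rightarrow> 'a set \<Rightarrow> 'a \<Rightarrow> real \<Rightarrow> bool" where
  "separates_dense f Q D e \<epsilon> \<longleftrightarrow>
     (\<forall>F\<subseteq>Q. finite F \<longrightarrow> (\<forall>x\<in>D. \<forall>\<delta>>0. \<exists>a\<in>D. (\<forall>q\<in>F. \<bar>q a - q x\<bar> < \<delta>) \<and> f a \<le> f e - \<epsilon>))"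

lemma separates_denseD:
  "separates_dense f Q D e \<epsilon> \<Longrightarrow> F \<subseteq> Q \<Longrightarrow> finite F \<Longrightarrow> x \<in> D \<Longrightarrow> \<delta> > 0 \<Longrightarrow>
    \<exists>a\<in>D. (\<forall>q\<in>F. \<bar>q a - q x\<bar> < \<delta>) \<and> f a \<le> f e - \<epsilon>"
  by (simp add: separates_dense_def)

lemma separates_dense_antimono:
  "separates_dense f Q D e \<epsilon> \<Longrightarrow> Q' \<subseteq> Q \<Longrightarrow> separates_dense f Q' D e \<epsilon>"
  unfolding separates_dense_def by (meson order_trans)

context embedded_banach_space
begin

text \<open>A single countable \<open>Q\<close> has to defeat all functionals of \<open>V\<close> at
  once. With \<open>V = dual_ball\<close> this provides the \<open>Q\<close> that the game
  needs.\<close>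

definition small :: "'a set \<Rightarrow> 'a \<Rightarrow> real \<Rightarrow> ('a \<Rightarrow> 'k) set \<Rightarrow> bool" where
  "small D e \<epsilon> V \<longleftrightarrow>
     (\<exists>Q. countable Q \<and> (\<forall>q\<in>Q. bounded_linear q) \<and> (\<forall>g\<in>V. \<not> separates_dense (re g) Q D e \<epsilon>))"

lemma small_mono: "small D e \<epsilon> W \<Longrightarrow> V \<subseteq> W \<Longrightarrow> small D e \<epsilon> V"
  unfolding small_def by blast

lemma small_empty: "small D e \<epsilon> {}"
  unfolding small_def by (intro exI[of _ "{}"]) auto

text \<open>The union of the countable families works, since density for a larger family is a
  stronger demand.\<close>

lemma small_UN:
  assumes "countable I" "\<And>i. i \<in> I \<Longrightarrow> small D e \<epsilon> (V i)"
  shows "small D e \<epsilon> (\<Union>i\<in>I. V i)"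
proof -
  obtain Q where Q: "\<And>i. i \<in> I \<Longrightarrow> countable (Q i) \<and> (\<forall>q\<in>Q i. bounded_linear q) \<and>
      (\<forall>g\<in>V i. \<not> separates_dense (re g) (Q i) D e \<epsilon>)"
    using assms(2) unfolding small_def by metis
  show ?thesis unfolding small_def
  proof (intro exI[of _ "\<Union>i\<in>I. Q i"] conjI ballI)
    show "countable (\<Union>i\<in>I. Q i)" using assms(1) Q by auto
  next
    fix g assume "g \<in> (\<Union>i\<in>I. V i)"
    then obtain i where "i \<in> I" "g \<in> V i" by auto
    then show "\<not> separates_dense (re g) (\<Union>i\<in>I. Q i) D e \<epsilon>"
      using Q separates_dense_antimono by (metis UN_upper)
  qed (use Q in auto)
qed

lemma small_Un: "small D e \<epsilon> V \<Longrightarrow> small D e \<epsilon> W \<Longrightarrow> small D e \<epsilon> (V \<union> W)"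
  using small_UN[of "{True, False}" D e \<epsilon> "\<lambda>b. if b then V else W"] by (auto simp: Un_commute)

text \<open>Remove from \<open>V\<close> the countably many small pieces
  \<open>V \<inter> A i\<close>. Afterwards a single functional of \<open>V'\<close> in
  \<open>A i\<close> certifies that \<open>V \<inter> A i\<close> is not small.\<close>

lemma prune:
  assumes "\<not> small D e \<epsilon> V" "countable I"
  obtains V' where "V' \<subseteq> V" "\<not> small D e \<epsilon> V'"
    "\<And>i. i \<in> I \<Longrightarrow> V' \<inter> A i \<noteq> {} \<Longrightarrow> \<not> small D e \<epsilon> (V \<inter> A i)"
proof -
  let ?I = "{i\<in>I. small D e \<epsilon> (V \<inter> A i)}"
  let ?V' = "V - (\<Union>i\<in>?I. V \<inter> A i)"
  have "small D e \<epsilon> (\<Union>i\<in>?I. V \<inter> A i)"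
    using assms(2) by (intro small_UN) (auto intro: countable_subset)
  moreover have "V \<subseteq> ?V' \<union> (\<Union>i\<in>?I. V \<inter> A i)" by blast
  ultimately have "\<not> small D e \<epsilon> ?V'"
    using assms(1) small_Un small_mono by meson
  then show ?thesis using that[of ?V'] by blast
qed

definition near :: "'a \<Rightarrow> real \<Rightarrow> complex \<Rightarrow> ('a \<Rightarrow> 'k) set" where
  "near d \<eta> z = {g. norm (emb (g d) - z) < \<eta>}"

text \<open>One point \<open>d\<close> splits all sets of the family simultaneously; only the second
  value \<open>w\<close> may change with the set.\<close>

definition splits :: "'a set \<Rightarrow> 'a \<Rightarrow> real \<Rightarrow> real \<Rightarrow> complex \<Rightarrow> complex set \<Rightarrow> ('a \<Rightarrow> 'k) set set \<Rightarrow> bool" where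
  "splits D e \<epsilon> \<eta> z J \<V> \<longleftrightarrow> (\<exists>d\<in>D. \<forall>V\<in>\<V>. \<not> small D e \<epsilon> (V \<inter> near d \<eta> z) \<and>
     (\<exists>w\<in>J. \<not> small D e \<epsilon> (V \<inter> near d \<eta> w)))"

text \<open>After pruning against all pairs of a point of \<open>D\<close> and a value in
  \<open>insert z W\<close>, it suffices to find one point \<open>x\<close> and, in each pruned set,
  one functional with value near \<open>z\<close> and one with low value at
  \<open>x\<close>.\<close>

lemma finite_family_splits:
  assumes D: "countable D" "e \<in> D" "\<And>x. x \<in> D \<Longrightarrow> norm x \<le> R" and \<eta>: "\<eta> > 0"
    and W: "finite W" "cball 0 R \<subseteq> (\<Union>w\<in>W. ball w \<eta>)"
    and \<V>: "finite \<V>" "\<And>V. V \<in> \<V> \<Longrightarrow> V \<subseteq> dual_ball \<inter> near e \<eta> z" "\<And>V. V \<in> \<V> \<Longrightarrow> \<not> small D e \<epsilon> V"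
  shows "splits D e \<epsilon> (2 * \<eta>) z {w\<in>W. Re w \<le> Re z - \<epsilon> + 3 * \<eta>} \<V>"
proof -
  define pruned where "pruned V V' \<longleftrightarrow> V' \<subseteq> V \<and> \<not> small D e \<epsilon> V' \<and>
      (\<forall>d\<in>D. \<forall>w\<in>insert z W. V' \<inter> near d (2 * \<eta>) w \<noteq> {} \<longrightarrow> \<not> small D e \<epsilon> (V \<inter> near d (2 * \<eta>) w))" for V V'
  have "\<exists>V'. pruned V V'"
    if V: "V \<in> \<V>" for V
  proof -
    have "countable (D \<times> insert z W)" using D(1) W(1) by (simp add: countable_finite)
    then obtain V' where V': "V' \<subseteq> V" "\<not> small D e \<epsilon> V'"
      "\<And>i. i \<in> D \<times> insert z W \<Longrightarrow> V' \<inter> near (fst i) (2 * \<eta>) (snd i) \<noteq> {} \<Longrightarrow>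
         \<not> small D e \<epsilon> (V \<inter> near (fst i) (2 * \<eta>) (snd i))"
      using prune[OF \<V>(3)[OF V], of "D \<times> insert z W" "\<lambda>i. near (fst i) (2 * \<eta>) (snd i)"] by blast
    have "\<not> small D e \<epsilon> (V \<inter> near d (2 * \<eta>) w)"
      if "d \<in> D" "w \<in> insert z W" "V' \<inter> near d (2 * \<eta>) w \<noteq> {}" for d w
      using V'(3)[of "(d, w)"] that by simp
    then show ?thesis unfolding pruned_def using V'(1,2) by blast
  qed
  then obtain p where "\<And>V. V \<in> \<V> \<Longrightarrow> pruned V (p V)" by metis
  then have p: "\<And>V. V \<in> \<V> \<Longrightarrow> p V \<subseteq> V" "\<And>V. V \<in> \<V> \<Longrightarrow> \<not> small D e \<epsilon> (p V)"
    "\<And>V d w. V \<in> \<V> \<Longrightarrow> d \<in> D \<Longrightarrow> w \<in> insert z W \<Longrightarrow> p V \<inter> near d (2 * \<eta>) w \<noteq> {} \<Longrightarrow>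
       \<not> small D e \<epsilon> (V \<inter> near d (2 * \<eta>) w)"
    unfolding pruned_def by blast+
  have "\<exists>f. f \<in> p V" if "V \<in> \<V>" for V
    using p(2)[OF that] small_empty by (metis ex_in_conv)
  then obtain f where f: "\<And>V. V \<in> \<V> \<Longrightarrow> f V \<in> p V" by metis
  have "g \<in> dual_ball" if "V \<in> \<V>" "g \<in> p V" for V g
    using p(1) \<V>(2) that by blast
  then have pK: "g \<in> dual_space scaleK" if "V \<in> \<V>" "g \<in> p V" for V g
    using that unfolding dual_ball_def by blast
  \<comment> \<open>Imaginary parts are recorded too, because \<open>near\<close> concerns the whole
    complex value.\<close>
  define Q0 where "Q0 = (\<lambda>V. re (f V)) ` \<V> \<union> (\<lambda>V. im (f V)) ` \<V>"
  have Q0: "finite Q0" "\<And>q. q \<in> Q0 \<Longrightarrow> bounded_linear q"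
    using \<V>(1) pK f unfolding Q0_def by (auto intro: re_bounded_linear im_bounded_linear)
  \<comment> \<open>The point \<open>e\<close> is high for every \<open>f V\<close>; the functionals that are low are chosen one after the
    other, each generic over all previous ones, so that making it low disturbs none of them.\<close>
  have low: "\<exists>g. \<exists>x\<in>D. (\<forall>V\<in>\<U>. g V \<in> p V \<and> re (g V) x \<le> re (g V) e - \<epsilon> + \<tau>) \<and>
      (\<forall>q\<in>Q0. \<bar>q x - q e\<bar> < \<tau>)" if "finite \<U>" "\<U> \<subseteq> \<V>" "\<tau> > 0" for \<U> \<tau>
    using that
  proof (induction \<U> arbitrary: \<tau> rule: finite_induct)
    case empty
    then show ?case using D(2) by (intro exI bexI[of _ e]) auto
  next
    case (insert V \<U>)
    have "\<exists>g. \<exists>x\<in>D. (\<forall>U\<in>\<U>. g U \<in> p U \<and> re (g U) x \<le> re (g U) e - \<epsilon> + \<tau> / 2) \<and>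
        (\<forall>q\<in>Q0. \<bar>q x - q e\<bar> < \<tau> / 2)"
      using insert.prems by (intro insert.IH) auto
    then obtain g x where gx: "x \<in> D" "\<And>U. U \<in> \<U> \<Longrightarrow> g U \<in> p U"
      "\<And>U. U \<in> \<U> \<Longrightarrow> re (g U) x \<le> re (g U) e - \<epsilon> + \<tau> / 2" "\<And>q. q \<in> Q0 \<Longrightarrow> \<bar>q x - q e\<bar> < \<tau> / 2"
      by blast
    define Q where "Q = Q0 \<union> (\<lambda>U. re (g U)) ` \<U>"
    have Q: "finite Q" "\<forall>q\<in>Q. bounded_linear q"
      using Q0 insert.hyps insert.prems gx(2) pK unfolding Q_def
      by (auto intro!: re_bounded_linear)
    have "\<not> small D e \<epsilon> (p V)" using p(2) insert.prems by simp
    then obtain k where k: "k \<in> p V" "separates_dense (re k) Q D e \<epsilon>"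
      using Q countable_finite[of Q] unfolding small_def by blast
    have "\<exists>a\<in>D. (\<forall>q\<in>Q. \<bar>q a - q x\<bar> < \<tau> / 2) \<and> re k a \<le> re k e - \<epsilon>"
      using insert.prems(2) by (intro separates_denseD[OF k(2) subset_refl Q(1) gx(1)]) simp
    then obtain a where a: "a \<in> D" "\<And>q. q \<in> Q \<Longrightarrow> \<bar>q a - q x\<bar> < \<tau> / 2" "re k a \<le> re k e - \<epsilon>"
      by blast
    show ?case
    proof (intro exI[of _ "g(V := k)"] bexI[of _ a] conjI ballI a(1))
      fix q assume q: "q \<in> Q0"
      then have "q \<in> Q" by (simp add: Q_def)
      then show "\<bar>q a - q e\<bar> < \<tau>"
        using a(2)[of q] gx(4)[OF q] by linarith
    next
      fix U assume U: "U \<in> insert V \<U>"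
      then show "(g(V := k)) U \<in> p U" using k gx(2) by auto
      show "re ((g(V := k)) U) a \<le> re ((g(V := k)) U) e - \<epsilon> + \<tau>"
      proof (cases "U = V")
        case True
        then show ?thesis using a(3) insert.prems(2) by simp
      next
        case False
        then have "U \<in> \<U>" "re (g U) \<in> Q" using U by (auto simp: Q_def)
        then have "re (g U) a \<le> re (g U) e - \<epsilon> + \<tau>"
          using a(2)[of "re (g U)"] gx(3)[of U] by linarith
        then show ?thesis using False by simp
      qed
    qed
  qed
  obtain g x where gx: "x \<in> D" "\<And>V. V \<in> \<V> \<Longrightarrow> g V \<in> p V"
    "\<And>V. V \<in> \<V> \<Longrightarrow> re (g V) x \<le> re (g V) e - \<epsilon> + \<eta> / 2" "\<And>q. q \<in> Q0 \<Longrightarrow> \<bar>q x - q e\<bar> < \<eta> / 2"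
    using low[OF \<V>(1) subset_refl half_gt_zero[OF \<eta>]] by blast
  show ?thesis
    unfolding splits_def
  proof (intro bexI[of _ x] ballI conjI gx(1))
    fix V assume V: "V \<in> \<V>"
    have fV: "f V \<in> near e \<eta> z" using f[OF V] p(1)[OF V] \<V>(2)[OF V] by blast
    have "norm (emb (f V x) - emb (f V e)) \<le> \<bar>re (f V) x - re (f V) e\<bar> + \<bar>im (f V) x - im (f V) e\<bar>"
      using cmod_le[of "emb (f V x) - emb (f V e)"] by (simp add: re_def im_def)
    also have "\<dots> < \<eta> / 2 + \<eta> / 2"
      using V by (intro add_strict_mono gx(4)) (auto simp: Q0_def)
    finally have "norm (emb (f V x) - z) < 2 * \<eta>"
      using fV norm_triangle_ineq[of "emb (f V x) - emb (f V e)" "emb (f V e) - z"]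
      by (simp add: near_def)
    then show "\<not> small D e \<epsilon> (V \<inter> near x (2 * \<eta>) z)"
      using p(3)[OF V gx(1), of z] f[OF V] unfolding near_def by blast
    have gV: "g V \<in> dual_ball" "g V \<in> near e \<eta> z"
      using gx(2)[OF V] p(1)[OF V] \<V>(2)[OF V] by blast+
    then have "norm (g V x) \<le> norm x" by (simp add: dual_ball_def)
    then have "emb (g V x) \<in> cball 0 R"
      using D(3)[OF gx(1)] by (simp add: norm_emb)
    then obtain w where w: "w \<in> W" "norm (emb (g V x) - w) < \<eta>"
      using W(2) by (force simp: dist_norm norm_minus_commute)
    have "\<not> small D e \<epsilon> (V \<inter> near x (2 * \<eta>) w)"
      using p(3)[OF V gx(1), of w] w(1) gx(2)[OF V] w(2) \<eta> unfolding near_def by fastforce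
    \<comment> \<open>The errors are \<open>\<eta>\<close> from the net \<open>W\<close>,
      \<open>\<eta> / 2\<close> from \<open>low\<close> and \<open>\<eta>\<close> from
      \<open>near e \<eta> z\<close>.\<close>
    moreover have "Re w \<le> Re z - \<epsilon> + 3 * \<eta>"
      using abs_Re_le_cmod[of "emb (g V x) - w"] abs_Re_le_cmod[of "emb (g V e) - z"] w(2) gV(2)
        gx(3)[OF V] by (simp add: near_def re_def)
    ultimately show "\<exists>w\<in>{w\<in>W. Re w \<le> Re z - \<epsilon> + 3 * \<eta>}. \<not> small D e \<epsilon> (V \<inter> near x (2 * \<eta>) w)"
      using w(1) by blast
  qed
qed

text \<open>The condition is hereditary: it ranges over all finite families of non-small subsets, so
  it can be used again on the pieces of an earlier split.\<close>

definition splitting :: "'a set \<Rightarrow> 'a \<Rightarrow> real \<Rightarrow> real \<Rightarrow> complex \<Rightarrow> complex set \<Rightarrow> ('a \<Rightarrow> 'k) set \<Rightarrow> bool" where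
  "splitting D e \<epsilon> \<eta> z J V \<longleftrightarrow>
     (\<forall>\<V>. finite \<V> \<and> (\<forall>U\<in>\<V>. U \<subseteq> V \<and> \<not> small D e \<epsilon> U) \<longrightarrow> splits D e \<epsilon> \<eta> z J \<V>)"

lemma splittingD:
  "splitting D e \<epsilon> \<eta> z J V \<Longrightarrow> finite \<V> \<Longrightarrow> (\<And>U. U \<in> \<V> \<Longrightarrow> U \<subseteq> V) \<Longrightarrow>
    (\<And>U. U \<in> \<V> \<Longrightarrow> \<not> small D e \<epsilon> U) \<Longrightarrow> splits D e \<epsilon> \<eta> z J \<V>"
  by (simp add: splitting_def)

text \<open>Only complex scalars need this: the low values of the functionals are then not controlled by their
  real parts, and a Ramsey argument on the finitely many approximate values makes them all equal.\<close>

lemma single_value_splitting: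
  assumes "finite J" "\<not> small D e \<epsilon> V" "splitting D e \<epsilon> \<eta> z J V"
  shows "\<exists>w\<in>J. \<exists>V'\<subseteq>V. \<not> small D e \<epsilon> V' \<and> splitting D e \<epsilon> \<eta> z {w} V'"
  using assms
proof (induction J arbitrary: V rule: finite_induct)
  case empty
  have "splits D e \<epsilon> \<eta> z {} {V}" using empty by (intro splittingD[OF empty(2)]) auto
  then show ?case by (auto simp: splits_def)
next
  case (insert k J)
  show ?case
  proof (cases "splitting D e \<epsilon> \<eta> z {k} V")
    case True
    then show ?thesis using insert.prems by blast
  next
    case False
    then obtain \<V> where \<V>: "finite \<V>" "\<And>U. U \<in> \<V> \<Longrightarrow> U \<subseteq> V" "\<And>U. U \<in> \<V> \<Longrightarrow> \<not> small D e \<epsilon> U"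
      and nk: "\<not> splits D e \<epsilon> \<eta> z {k} \<V>"
      unfolding splitting_def by auto
    \<comment> \<open>Otherwise each \<open>U\<close> has a family \<open>\<W> U\<close> that
      \<open>J\<close> does not split. A common point for \<open>\<V>\<close> and all these families
      must use \<open>k\<close> on some member of each \<open>\<W> U\<close>, hence on each
      \<open>U\<close>, against the choice of \<open>\<V>\<close>.\<close>
    have "\<exists>U\<in>\<V>. splitting D e \<epsilon> \<eta> z J U"
    proof (rule ccontr)
      assume "\<not> ?thesis"
      then have "\<forall>U\<in>\<V>. \<exists>\<W>. (finite \<W> \<and> (\<forall>U'\<in>\<W>. U' \<subseteq> U \<and> \<not> small D e \<epsilon> U')) \<and> \<not> splits D e \<epsilon> \<eta> z J \<W>"
        unfolding splitting_def by auto
      then have "\<exists>\<W>. \<forall>U\<in>\<V>. (finite (\<W> U) \<and> (\<forall>U'\<in>\<W> U. U' \<subseteq> U \<and> \<not> small D e \<epsilon> U')) \<and> \<not> splits D e \<epsilon> \<eta> z J (\<W> U)"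
        by (rule bchoice)
      then obtain \<W> where \<W>: "\<And>U. U \<in> \<V> \<Longrightarrow> finite (\<W> U)"
        "\<And>U U'. U \<in> \<V> \<Longrightarrow> U' \<in> \<W> U \<Longrightarrow> U' \<subseteq> U \<and> \<not> small D e \<epsilon> U'"
        "\<And>U. U \<in> \<V> \<Longrightarrow> \<not> splits D e \<epsilon> \<eta> z J (\<W> U)" by auto
      have "U \<subseteq> V \<and> \<not> small D e \<epsilon> U" if UV: "U \<in> \<V> \<union> (\<Union>U\<in>\<V>. \<W> U)" for U
      proof -
        consider "U \<in> \<V>" | U' where "U' \<in> \<V>" "U \<in> \<W> U'" using UV by blast
        then show ?thesis by cases (use \<V> \<W>(2) in blast)+
      qed
      then have "splits D e \<epsilon> \<eta> z (insert k J) (\<V> \<union> (\<Union>U\<in>\<V>. \<W> U))"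
        using \<V>(1) \<W>(1) by (intro splittingD[OF insert.prems(2)]) auto
      then obtain d where d: "d \<in> D" "\<And>U. U \<in> \<V> \<union> (\<Union>U\<in>\<V>. \<W> U) \<Longrightarrow> \<not> small D e \<epsilon> (U \<inter> near d \<eta> z) \<and>
         (\<exists>w\<in>insert k J. \<not> small D e \<epsilon> (U \<inter> near d \<eta> w))" unfolding splits_def by blast
      have "\<not> small D e \<epsilon> (U \<inter> near d \<eta> k)" if U: "U \<in> \<V>" for U
      proof -
        obtain U' where U': "U' \<in> \<W> U" "\<not> (\<exists>w\<in>J. \<not> small D e \<epsilon> (U' \<inter> near d \<eta> w))"
          using \<W>(3)[OF U] d U unfolding splits_def by blast
        then have "\<not> small D e \<epsilon> (U' \<inter> near d \<eta> k)" using d(2)[of U'] U by auto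
        then show ?thesis using \<W>(2)[OF U U'(1)] small_mono by (meson Int_mono subset_refl)
      qed
      then have "splits D e \<epsilon> \<eta> z {k} \<V>" using d unfolding splits_def by blast
      then show False using nk by simp
    qed
    then obtain U where U: "U \<in> \<V>" "splitting D e \<epsilon> \<eta> z J U" by blast
    show ?thesis using insert.IH[OF \<V>(3)[OF U(1)] U(2)] \<V>(2)[OF U(1)] by (meson insertI2 order_trans)
  qed
qed

text \<open>A Cantor scheme: the \<open>n\<close>-th point splits every set of the
  \<open>n\<close>-th family, and both halves of each set enter the next family. Every pattern of
  \<open>z\<close> and \<open>w\<close> then follows a branch of nonempty sets.\<close>

lemma independent_sequence:
  assumes V: "\<not> small D e \<epsilon> V"
    and split: "splitting D e \<epsilon> \<eta> z {w} V"
  obtains d :: "nat \<Rightarrow> 'a" where "range d \<subseteq> D"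
    "\<And>n S. \<exists>g\<in>V. \<forall>i<n. norm (emb (g (d i)) - (if i \<in> S then z else w)) < \<eta>"
proof -
  define nxt where "nxt d \<V> = (\<lambda>U. U \<inter> near d \<eta> z) ` \<V> \<union> (\<lambda>U. U \<inter> near d \<eta> w) ` \<V>" for d \<V>
  define ok where "ok \<V> \<longleftrightarrow> finite \<V> \<and> (\<forall>U\<in>\<V>. U \<subseteq> V \<and> \<not> small D e \<epsilon> U)" for \<V>
  have step: "\<exists>d\<in>D. ok (nxt d \<V>)" if ok: "ok \<V>" for \<V>
  proof -
    have "splits D e \<epsilon> \<eta> z {w} \<V>"
      using ok by (intro splittingD[OF split]) (auto simp: ok_def)
    then obtain d where "d \<in> D" "\<And>U. U \<in> \<V> \<Longrightarrow> \<not> small D e \<epsilon> (U \<inter> near d \<eta> z)"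
      "\<And>U. U \<in> \<V> \<Longrightarrow> \<not> small D e \<epsilon> (U \<inter> near d \<eta> w)"
      unfolding splits_def by blast
    then have "d \<in> D" "ok (nxt d \<V>)" using ok unfolding ok_def nxt_def by auto
    then show ?thesis by blast
  qed
  \<comment> \<open>A state pairs the current family with a point already chosen to split it, so
    that the next family is determined.\<close>
  define inv where "inv n x \<longleftrightarrow> ok (fst x) \<and> snd x \<in> D \<and> ok (nxt (snd x) (fst x)) \<and> (n = 0 \<longrightarrow> fst x = {V})"
    for n :: nat and x
  have "\<exists>s. \<forall>n. inv n (s n) \<and> fst (s (Suc n)) = nxt (snd (s n)) (fst (s n))"
  proof (rule dependent_nat_choice)
    have ok: "ok {V}" using V by (simp add: ok_def)
    then obtain d where "d \<in> D" "ok (nxt d {V})" using step by blast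
    then have "inv 0 ({V}, d)" using ok by (simp add: inv_def)
    then show "\<exists>x. inv 0 x" ..
  next
    fix x n assume x: "inv n x"
    then obtain d where "d \<in> D" "ok (nxt d (nxt (snd x) (fst x)))"
      using step[of "nxt (snd x) (fst x)"] by (auto simp: inv_def)
    then have "inv (Suc n) (nxt (snd x) (fst x), d)" using x by (simp add: inv_def)
    then show "\<exists>y. inv (Suc n) y \<and> fst y = nxt (snd x) (fst x)" by (metis fst_conv)
  qed
  then obtain s where "\<forall>n. inv n (s n) \<and> fst (s (Suc n)) = nxt (snd (s n)) (fst (s n))" ..
  then have s: "\<And>n. ok (fst (s n))" "\<And>n. snd (s n) \<in> D" "fst (s 0) = {V}"
    "\<And>n. fst (s (Suc n)) = nxt (snd (s n)) (fst (s n))" unfolding inv_def by auto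
  have branch: "\<exists>U\<in>fst (s n). \<forall>g\<in>U. \<forall>i<n. g \<in> near (snd (s i)) \<eta> (if i \<in> S then z else w)" for n S
  proof (induction n)
    case 0
    then show ?case using s(3) by simp
  next
    case (Suc n)
    then obtain U where U: "U \<in> fst (s n)"
      "\<And>g i. g \<in> U \<Longrightarrow> i < n \<Longrightarrow> g \<in> near (snd (s i)) \<eta> (if i \<in> S then z else w)" by blast
    show ?case
      by (rule bexI[of _ "U \<inter> near (snd (s n)) \<eta> (if n \<in> S then z else w)"])
        (use U in \<open>auto simp: s(4) nxt_def less_Suc_eq\<close>)
  qed
  show ?thesis
  proof (rule that[of "\<lambda>n. snd (s n)"])
    fix n S
    obtain U where U: "U \<in> fst (s n)"
      "\<And>g i. g \<in> U \<Longrightarrow> i < n \<Longrightarrow> g \<in> near (snd (s i)) \<eta> (if i \<in> S then z else w)"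
      using branch[of n S] by blast
    then have "U \<subseteq> V" "\<not> small D e \<epsilon> U" using s(1)[of n] by (auto simp: ok_def)
    then obtain g where "g \<in> U" "g \<in> V" using small_empty by (metis ex_in_conv subsetD)
    then show "\<exists>g\<in>V. \<forall>i<n. norm (emb (g (snd (s i))) - (if i \<in> S then z else w)) < \<eta>"
      using U(2) unfolding near_def by blast
  qed (use s(2) in auto)
qed

text \<open>Finitely many discs cover the possible values at \<open>e\<close>, so some disc carries
  a non-small set. There the values that occur are made uniform and the Cantor scheme is
  run.\<close>

theorem l1_sequence_if_not_small:
  assumes D: "countable D" "e \<in> D" "\<And>x. x \<in> D \<Longrightarrow> norm x \<le> R" and "\<epsilon> > 0"
    and ns: "\<not> small D e \<epsilon> dual_ball"
  obtains d where "range d \<subseteq> D" "equivalent_to_l1_basis scaleK d"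
proof -
  \<comment> \<open>Splitting has tolerance \<open>2 * \<eta>\<close>, so the gap must exceed
    \<open>8 * \<eta>\<close>; the real parts of \<open>z\<close> and \<open>w\<close> differ by at
    least \<open>\<epsilon> - 3 * \<eta> = 17 * \<eta>\<close>.\<close>
  define \<eta> where "\<eta> = \<epsilon> / 20"
  have \<eta>: "\<eta> > 0" using \<open>\<epsilon> > 0\<close> by (simp add: \<eta>_def)
  have "compact (cball (0::complex) R)" by simp
  then obtain W where W: "finite W" "cball (0::complex) R \<subseteq> (\<Union>w\<in>W. ball w \<eta>)"
    using \<eta> unfolding compact_eq_totally_bounded by blast
  have "\<exists>z\<in>W. \<not> small D e \<epsilon> (dual_ball \<inter> near e \<eta> z)"
  proof (rule ccontr)
    assume "\<not> ?thesis"
    then have "small D e \<epsilon> (\<Union>z\<in>W. dual_ball \<inter> near e \<eta> z)"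
      using W(1) by (intro small_UN) (auto simp: countable_finite)
    moreover have "dual_ball \<subseteq> (\<Union>z\<in>W. dual_ball \<inter> near e \<eta> z)"
    proof
      fix g assume g: "g \<in> dual_ball"
      then have "norm (g e) \<le> norm e" by (simp add: dual_ball_def)
      then have "emb (g e) \<in> cball 0 R"
        using D(3)[OF D(2)] by (simp add: norm_emb)
      then obtain w where "w \<in> W" "norm (emb (g e) - w) < \<eta>"
        using W(2) by (force simp: dist_norm norm_minus_commute)
      then show "g \<in> (\<Union>z\<in>W. dual_ball \<inter> near e \<eta> z)"
        using g unfolding near_def by blast
    qed
    ultimately show False using ns small_mono by blast
  qed
  then obtain z where z: "\<not> small D e \<epsilon> (dual_ball \<inter> near e \<eta> z)" by blast
  define J where "J = {w\<in>W. Re w \<le> Re z - \<epsilon> + 3 * \<eta>}"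
  have "splitting D e \<epsilon> (2 * \<eta>) z J (dual_ball \<inter> near e \<eta> z)"
    unfolding splitting_def J_def using D \<eta> W by (intro allI impI finite_family_splits) auto
  moreover have "finite J" using W(1) by (simp add: J_def)
  ultimately obtain w V where w: "w \<in> J" and V: "V \<subseteq> dual_ball" "\<not> small D e \<epsilon> V"
    "splitting D e \<epsilon> (2 * \<eta>) z {w} V"
    using single_value_splitting z by (metis (no_types, lifting) Int_subset_iff)
  obtain d :: "nat \<Rightarrow> 'a" where d: "range d \<subseteq> D"
    "\<And>n S. \<exists>g\<in>V. \<forall>i<n. norm (emb (g (d i)) - (if i \<in> S then z else w)) < 2 * \<eta>"
    using independent_sequence[OF V(2,3)] by blast
  have "4 * (2 * \<eta>) < norm (z - w)"
    using w abs_Re_le_cmod[of "z - w"] \<open>\<epsilon> > 0\<close> by (simp add: J_def \<eta>_def)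
  then have "equivalent_to_l1_basis scaleK d"
  proof (rule independent_imp_l1_basis[rotated])
    show "norm (d i) \<le> R" for i using d(1) D(3) by auto
    show "\<exists>g\<in>dual_ball. \<forall>i<n. norm (emb (g (d i)) - (if i \<in> S then z else w)) < 2 * \<eta>" for n S
      using d(2)[of n S] V(1) by blast
  qed
  then show ?thesis using that d(1) by blast
qed

end

section \<open>The slicing game\<close>

lemma convex_hull_finite_support:
  assumes "x \<in> convex hull S"
  obtains F where "finite F" "F \<subseteq> S" "x \<in> convex hull F"
proof -
  obtain F u where F: "finite F" "F \<subseteq> S" "\<forall>x\<in>F. 0 \<le> u x" "sum u F = 1" "(\<Sum>v\<in>F. u v *\<^sub>R v) = x"
    using assms unfolding convex_hull_explicit by blast
  then have "x \<in> convex hull F"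
    by (auto simp: convex_hull_finite)
  then show ?thesis using that F(1,2) by blast
qed

lemma closure_convex_hull_countable_support:
  fixes f :: "'m \<Rightarrow> 'a::real_normed_vector"
  assumes "x \<in> closure (convex hull (f ` S))"
  shows "\<exists>C\<subseteq>S. countable C \<and> x \<in> closure (convex hull (f ` C))"
proof -
  obtain y where y: "\<And>n. y n \<in> convex hull (f ` S)" "y \<longlonglongrightarrow> x"
    using assms unfolding closure_sequential by blast
  have "\<exists>C\<subseteq>S. finite C \<and> y n \<in> convex hull (f ` C)" for n
    using convex_hull_finite_support[OF y(1)[of n]] by (metis finite_subset_image)
  then obtain C where C: "\<And>n. C n \<subseteq> S" "\<And>n. finite (C n)" "\<And>n. y n \<in> convex hull (f ` C n)"
    by metis
  have "y n \<in> convex hull (f ` (\<Union>n. C n))" for n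
    using C(3)[of n] hull_mono[of "f ` C n" "f ` (\<Union>n. C n)" convex] by blast
  then have "x \<in> closure (convex hull (f ` (\<Union>n. C n)))"
    using y(2) unfolding closure_sequential by blast
  then show ?thesis
    using C by (intro exI[of _ "\<Union>n. C n"]) (auto simp: countable_finite)
qed

text \<open>An abstract form of the game. By \<open>answer\<close>, from any position
  \<open>v\<close> the moves that lengthen \<open>v\<close> almost fully still have slopes whose
  closed convex hull contains every slope.\<close>

locale slicing_game =
  fixes P :: "'m set" and vec slp :: "'m \<Rightarrow> 'a::real_normed_vector" and L :: real
  assumes norm_vec: "m \<in> P \<Longrightarrow> norm (vec m) = 1"
    and norm_slp: "m \<in> P \<Longrightarrow> norm (slp m) \<le> L"
    and answer: "m \<in> P \<Longrightarrow> \<sigma> > 0 \<Longrightarrow>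
      slp m \<in> closure (convex hull (slp ` {m'\<in>P. norm (v + vec m') > norm v + 1 - \<sigma>}))"
begin

definition avg :: "'m list \<Rightarrow> 'a" where
  "avg l = (1 / real (length l)) *\<^sub>R sum_list (map slp l)"

text \<open>One tolerance \<open>\<epsilon>\<close> bounds the total defect of the play, however
  long it is.\<close>

definition valid :: "real \<Rightarrow> 'a \<Rightarrow> 'm list \<Rightarrow> bool" where
  "valid \<epsilon> e ms \<longleftrightarrow> norm (e + sum_list (map vec ms)) > norm e + real (length ms) - \<epsilon>"

lemma valid_answer:
  assumes "valid \<epsilon> e ms" "z \<in> P"
  shows "slp z \<in> closure (convex hull (slp ` {m\<in>P. valid \<epsilon> e (m # ms)}))"
proof -
  define v where "v = e + sum_list (map vec ms)"
  \<comment> \<open>The slack left in the strict inequality is what the next move may spend.\<close>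
  define \<sigma> where "\<sigma> = norm v - (norm e + real (length ms) - \<epsilon>)"
  have "\<sigma> > 0" using assms(1) by (simp add: \<sigma>_def v_def valid_def)
  then have "slp z \<in> closure (convex hull (slp ` {m\<in>P. norm (v + vec m) > norm v + 1 - \<sigma>}))"
    using assms(2) answer by blast
  moreover have "{m\<in>P. norm (v + vec m) > norm v + 1 - \<sigma>} \<subseteq> {m\<in>P. valid \<epsilon> e (m # ms)}"
    by (auto simp: valid_def v_def \<sigma>_def algebra_simps)
  ultimately show ?thesis
    by (meson closure_mono hull_mono image_mono subsetD)
qed

text \<open>A closing-off argument: each question \<open>(l, ms, z)\<close> is answered by countably
  many moves. Countability lets one play meet all requirements and fits the countable sets in the
  Asplund and \<open>small\<close> conditions.\<close>

lemma countable_subgame: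
  assumes "countable Z0" "Z0 \<subseteq> P"
  obtains Z where "countable Z" "Z0 \<subseteq> Z" "Z \<subseteq> P"
    "\<And>l ms z. l \<in> lists Z \<Longrightarrow> ms \<in> lists Z \<Longrightarrow> z \<in> Z \<Longrightarrow> valid \<epsilon> (avg l) ms \<Longrightarrow>
      slp z \<in> closure (convex hull (slp ` {m\<in>Z. valid \<epsilon> (avg l) (m # ms)}))"
proof -
  define good where "good l ms z C \<longleftrightarrow> countable C \<and> C \<subseteq> {m\<in>P. valid \<epsilon> (avg l) (m # ms)} \<and>
    (valid \<epsilon> (avg l) ms \<and> z \<in> P \<longrightarrow> slp z \<in> closure (convex hull (slp ` C)))" for l ms z C
  have "\<exists>C. good l ms z C" for l ms z
  proof (cases "valid \<epsilon> (avg l) ms \<and> z \<in> P")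
    case True
    then show ?thesis
      using closure_convex_hull_countable_support[OF valid_answer[of \<epsilon> "avg l" ms z]]
      unfolding good_def by blast
  next
    case False
    then show ?thesis by (auto simp: good_def)
  qed
  then obtain h where h: "\<And>l ms z. good l ms z (h l ms z)" by metis
  \<comment> \<open>Iterating \<open>step\<close> countably often is enough, since a finite list of
    moves already lies in one stage.\<close>
  define step where "step A = A \<union> (\<Union>(l, ms, z)\<in>lists A \<times> lists A \<times> A. h l ms z)" for A
  define Zn where "Zn n = (step ^^ n) Z0" for n
  define Z where "Z = (\<Union>n. Zn n)"
  have Suc: "Zn (Suc n) = step (Zn n)" for n by (simp add: Zn_def)
  have "countable (Zn n) \<and> Zn n \<subseteq> P" for n
  proof (induction n)
    case 0
    then show ?case using assms by (simp add: Zn_def)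
  next
    case (Suc n)
    then have "countable (lists (Zn n) \<times> lists (Zn n) \<times> Zn n)" by (intro countable_SIGMA countable_lists) auto
    then show ?case unfolding \<open>Zn (Suc n) = step (Zn n)\<close> step_def
      using Suc h unfolding good_def by (auto intro!: countable_UN)
  qed
  then have Z: "countable Z" "Z \<subseteq> P" unfolding Z_def by blast+
  have mono: "Zn m \<subseteq> Zn n" if "m \<le> n" for m n
    using that by (induction rule: dec_induct) (auto simp: Suc step_def)
  have lists: "\<exists>n. l \<in> lists (Zn n)" if "l \<in> lists Z" for l
    using that
  proof (induction l)
    case (Cons m l)
    then obtain n k where "l \<in> lists (Zn n)" "m \<in> Zn k" by (auto simp: Z_def)
    then show ?case
      using mono[of n "max n k"] mono[of k "max n k"] by (intro exI[of _ "max n k"]) auto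
  qed auto
  show ?thesis
  proof (rule that[of Z])
    show "Z0 \<subseteq> Z" using Zn_def[of 0] by (auto simp: Z_def)
    fix l ms z assume A: "l \<in> lists Z" "ms \<in> lists Z" "z \<in> Z" "valid \<epsilon> (avg l) ms"
    obtain i j k where "l \<in> lists (Zn i)" "ms \<in> lists (Zn j)" "z \<in> Zn k"
      using lists[OF A(1)] lists[OF A(2)] A(3) by (auto simp: Z_def)
    then have "l \<in> lists (Zn (i + j + k))" "ms \<in> lists (Zn (i + j + k))" "z \<in> Zn (i + j + k)"
      using mono[of i "i + j + k"] mono[of j "i + j + k"] mono[of k "i + j + k"] by auto
    then have "h l ms z \<subseteq> Zn (Suc (i + j + k))" unfolding Suc step_def by blast
    then have "h l ms z \<subseteq> {m\<in>Z. valid \<epsilon> (avg l) (m # ms)}"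
      using h[of l ms z] unfolding good_def Z_def by blast
    moreover have "slp z \<in> closure (convex hull (slp ` h l ms z))"
      using h[of l ms z] A Z(2) unfolding good_def by blast
    ultimately show "slp z \<in> closure (convex hull (slp ` {m\<in>Z. valid \<epsilon> (avg l) (m # ms)}))"
      by (meson closure_mono hull_mono image_mono subsetD)
  qed (use Z in auto)
qed

end

section \<open>Steering plays with countably many moves\<close>

locale countable_slicing_game = slicing_game P vec slp L
  for P :: "'m set" and vec slp :: "'m \<Rightarrow> 'a::real_normed_vector" and L :: real +
  fixes Z :: "'m set" and \<epsilon> :: real
  assumes \<epsilon>: "\<epsilon> > 0" and countable_Z: "countable Z" and Z_sub: "Z \<subseteq> P"
    and answer_Z: "l \<in> lists Z \<Longrightarrow> ms \<in> lists Z \<Longrightarrow> z \<in> Z \<Longrightarrow> valid \<epsilon> (avg l) ms \<Longrightarrow>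
      slp z \<in> closure (convex hull (slp ` {m\<in>Z. valid \<epsilon> (avg l) (m # ms)}))"
begin

text \<open>Lists allow repetitions, so these averages are the rational convex combinations of
  slopes: a countable set, dense in their closed convex hull.\<close>

definition D :: "'a set" where
  "D = avg ` (lists Z - {[]})"

lemma linear_avg:
  fixes f :: "'a \<Rightarrow> real"
  shows "linear f \<Longrightarrow> f (avg l) = (1 / real (length l)) * (\<Sum>m\<leftarrow>l. f (slp m))"
  unfolding avg_def by (induction l) (auto simp: linear_scale linear_add linear_0 scaleR_add_right algebra_simps)

lemma linear_sum_list: "linear f \<Longrightarrow> f (sum_list (map g l)) = (\<Sum>m\<leftarrow>l. f (g m))"
  by (induction l) (auto simp: linear_add linear_0)

text \<open>Some slope averaged in \<open>x0\<close> has \<open>\<phi>\<close> at most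
  \<open>\<phi> x0\<close>. It lies in the closed convex hull of the slopes of legal moves, so these
  cannot all have values at least \<open>\<phi> x0 + \<eta>\<close>.\<close>

lemma answer_in_slice:
  fixes \<phi> :: "'a \<Rightarrow> real"
  assumes "e \<in> D" "x0 \<in> D" "ms \<in> lists Z" "valid \<epsilon> e ms" "bounded_linear \<phi>" "\<eta> > 0"
  shows "\<exists>m\<in>Z. valid \<epsilon> e (m # ms) \<and> \<phi> (slp m) < \<phi> x0 + \<eta>"
proof (rule ccontr)
  assume no: "\<not> ?thesis"
  obtain l where l: "l \<in> lists Z" "e = avg l" using assms(1) by (auto simp: D_def)
  obtain l0 where l0: "l0 \<in> lists Z" "l0 \<noteq> []" "x0 = avg l0" using assms(2) by (auto simp: D_def)
  have lin: "linear \<phi>" using assms(5) by (rule bounded_linear.linear)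
  have "\<exists>z\<in>set l0. \<phi> (slp z) \<le> \<phi> x0"
  proof (rule ccontr)
    assume "\<not> ?thesis"
    then have "(\<Sum>z\<leftarrow>l0. \<phi> x0) < (\<Sum>z\<leftarrow>l0. \<phi> (slp z))"
      using l0(2) by (intro sum_list_strict_mono) auto
    then have "real (length l0) * \<phi> x0 < real (length l0) * \<phi> x0"
      using l0(2) by (simp add: linear_avg[OF lin] l0(3) sum_list_triv)
    then show False by simp
  qed
  then obtain z where z: "z \<in> Z" "\<phi> (slp z) \<le> \<phi> x0" using l0(1) by auto
  let ?H = "{y. \<phi> y \<ge> \<phi> x0 + \<eta>}"
  have "closed ?H"
    using assms(5) by (intro closed_Collect_le continuous_intros linear_continuous_on) auto
  moreover have "convex ?H"
    using convex_linear_vimage[OF lin, of "{\<phi> x0 + \<eta>..}"] by (simp add: vimage_def)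
  moreover have "slp ` {m\<in>Z. valid \<epsilon> e (m # ms)} \<subseteq> ?H" using no by force
  ultimately have "closure (convex hull (slp ` {m\<in>Z. valid \<epsilon> e (m # ms)})) \<subseteq> ?H"
    by (intro closure_minimal hull_minimal) auto
  then have "\<phi> (slp z) \<ge> \<phi> x0 + \<eta>"
    using answer_Z[OF l(1) assms(3) z(1)] assms(4) l(2) by auto
  then show False using z(2) assms(6) by simp
qed

text \<open>Steering the average of the answers to \<open>x0\<close> as in Blackwell's approachability theorem:
  the next slice always points from the current average towards \<open>x0\<close>.\<close>

lemma force_average:
  fixes F :: "('a \<Rightarrow> real) set"
  assumes e: "e \<in> D" and x0: "x0 \<in> D" and ms: "ms \<in> lists Z" "valid \<epsilon> e ms"
    and F: "finite F" "\<And>q. q \<in> F \<Longrightarrow> bounded_linear q" and \<delta>: "\<delta> > 0"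
  shows "\<exists>us\<in>lists Z. us \<noteq> [] \<and> valid \<epsilon> e (us @ ms) \<and> (\<forall>q\<in>F. \<bar>q (avg us) - q x0\<bar> < \<delta>)"
proof -
  have lin: "linear q" if "q \<in> F" for q using F(2)[OF that] by (rule bounded_linear.linear)
  have "\<exists>c. \<forall>m\<in>P. (q (slp m) - q x0)\<^sup>2 \<le> c" if qF: "q \<in> F" for q
  proof -
    obtain K where K: "K > 0" "\<And>x. norm (q x) \<le> norm x * K"
      using bounded_linear.pos_bounded[OF F(2)[OF qF]] by blast
    have "(q (slp m) - q x0)\<^sup>2 \<le> (L * K + \<bar>q x0\<bar>)\<^sup>2" if "m \<in> P" for m
    proof -
      have "\<bar>q (slp m)\<bar> \<le> L * K"
        using K(2)[of "slp m"] norm_slp[OF that] K(1) by (simp add: mult_right_mono order_trans)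
      then have "\<bar>q (slp m) - q x0\<bar> \<le> L * K + \<bar>q x0\<bar>" by linarith
      then show ?thesis by (metis abs_ge_zero power2_abs power_mono)
    qed
    then show ?thesis by blast
  qed
  then obtain c where c: "\<And>q m. q \<in> F \<Longrightarrow> m \<in> P \<Longrightarrow> (q (slp m) - q x0)\<^sup>2 \<le> c q" by metis
  define C where "C = \<bar>sum c F\<bar>"
  \<comment> \<open>The unnormalised deviation of the average from \<open>x0\<close>, as seen by
    \<open>q\<close>.\<close>
  define A where "A us q = q (sum_list (map slp us)) - real (length us) * q x0" for us q
  have "\<exists>us\<in>lists Z. length us = n \<and> valid \<epsilon> e (us @ ms) \<and> (\<Sum>q\<in>F. (A us q)\<^sup>2) \<le> real n * (C + 1)" for n
  proof (induction n)
    case 0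
    then show ?case using ms lin by (intro bexI[of _ "[]"]) (auto simp: A_def linear_0)
  next
    case (Suc n)
    then obtain us where us: "us \<in> lists Z" "length us = n" "valid \<epsilon> e (us @ ms)"
      "(\<Sum>q\<in>F. (A us q)\<^sup>2) \<le> real n * (C + 1)" by blast
    \<comment> \<open>Half the derivative of the sum of squares; keeping \<open>\<phi>\<close>
      almost below \<open>\<phi> x0\<close> bounds the cross term by \<open>1\<close>, so the sum
      grows only linearly.\<close>
    define \<phi> where "\<phi> y = (\<Sum>q\<in>F. A us q * q y)" for y
    have "bounded_linear \<phi>" unfolding \<phi>_def
      using F(2) by (intro bounded_linear_sum bounded_linear_const_mult)
    moreover have "us @ ms \<in> lists Z" using us(1) ms(1) by auto
    ultimately obtain m where m: "m \<in> Z" "valid \<epsilon> e (m # us @ ms)" "\<phi> (slp m) < \<phi> x0 + 1 / 2"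
      using answer_in_slice[OF e x0 _ us(3), of \<phi> "1/2"] by auto
    have A_Cons: "A (m # us) q = A us q + (q (slp m) - q x0)" if "q \<in> F" for q
      using lin[OF that] by (simp add: A_def linear_add algebra_simps)
    have "(\<Sum>q\<in>F. (A (m # us) q)\<^sup>2) = (\<Sum>q\<in>F. (A us q)\<^sup>2 + 2 * (A us q * q (slp m) - A us q * q x0)
        + (q (slp m) - q x0)\<^sup>2)"
      by (intro sum.cong refl, subst A_Cons, assumption) (simp add: power2_eq_square algebra_simps)
    also have "\<dots> = (\<Sum>q\<in>F. (A us q)\<^sup>2) + 2 * (\<phi> (slp m) - \<phi> x0) + (\<Sum>q\<in>F. (q (slp m) - q x0)\<^sup>2)"
      by (simp add: sum.distrib sum_subtractf sum_distrib_left[symmetric] \<phi>_def)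
    also have "\<dots> \<le> real n * (C + 1) + 1 + C"
    proof -
      have "(\<Sum>q\<in>F. (q (slp m) - q x0)\<^sup>2) \<le> sum c F"
        using c m(1) Z_sub by (intro sum_mono) auto
      then show ?thesis using us(4) m(3) by (simp add: C_def)
    qed
    finally have "(\<Sum>q\<in>F. (A (m # us) q)\<^sup>2) \<le> real (Suc n) * (C + 1)" by (simp add: algebra_simps)
    then show ?case using us m by (intro bexI[of _ "m # us"]) auto
  qed
  \<comment> \<open>With this \<open>n\<close> the linear bound \<open>n * (C + 1)\<close> falls
    below the square of \<open>n * \<delta>\<close>.\<close>
  moreover obtain n where n: "real n > (C + 1) / \<delta>\<^sup>2" using reals_Archimedean2 by blast
  have "C \<ge> 0" by (simp add: C_def)
  then have "(C + 1) / \<delta>\<^sup>2 > 0" using \<delta> by simp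
  then have n0: "n > 0" using n by (metis gr0I less_asym of_nat_0)
  ultimately obtain us where us: "us \<in> lists Z" "length us = n" "valid \<epsilon> e (us @ ms)"
      "(\<Sum>q\<in>F. (A us q)\<^sup>2) \<le> real n * (C + 1)" by blast
  have "\<bar>q (avg us) - q x0\<bar> < \<delta>" if q: "q \<in> F" for q
  proof -
    have "(A us q)\<^sup>2 \<le> (\<Sum>q\<in>F. (A us q)\<^sup>2)"
      using F(1) q by (intro member_le_sum) auto
    also have "\<dots> \<le> real n * (C + 1)" by (rule us(4))
    also have "\<dots> < real n * (real n * \<delta>\<^sup>2)"
      using n n0 \<delta> by (intro mult_strict_left_mono) (auto simp: field_simps)
    also have "\<dots> = (real n * \<delta>)\<^sup>2" by (simp add: power2_eq_square)
    finally have "\<bar>A us q\<bar> < real n * \<delta>"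
      using \<delta> by (metis abs_le_square_iff abs_of_nonneg less_eq_real_def mult_nonneg_nonneg not_less of_nat_0_le_iff)
    moreover have "A us q = real n * (q (avg us) - q x0)"
      using lin[OF q] us(2) n0 by (simp add: A_def avg_def linear_scale right_diff_distrib)
    ultimately show ?thesis using n0 by (simp add: abs_mult)
  qed
  then show ?thesis using us n0 by (intro bexI[of _ us]) auto
qed

text \<open>All requirements are enumerated and the \<open>n\<close>-th one is met by a block of
  moves at stage \<open>n\<close>. Blocks are only added, so one play meets them all.\<close>

lemma infinite_play:
  fixes Q :: "('a \<Rightarrow> real) set"
  assumes e: "e \<in> D" and Q: "countable Q" "\<And>q. q \<in> Q \<Longrightarrow> bounded_linear q"
  obtains ms where "\<And>n. ms n \<in> lists Z" "\<And>n. valid \<epsilon> e (ms n)" "\<And>n. set (ms n) \<subseteq> set (ms (Suc n))"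
    "\<And>F x \<delta>. F \<subseteq> Q \<Longrightarrow> finite F \<Longrightarrow> x \<in> D \<Longrightarrow> \<delta> > 0 \<Longrightarrow>
      \<exists>n us. us \<in> lists Z \<and> us \<noteq> [] \<and> set us \<subseteq> set (ms n) \<and> (\<forall>q\<in>F. \<bar>q (avg us) - q x\<bar> < \<delta>)"
proof -
  \<comment> \<open>The third component \<open>k\<close> stands for the tolerance
    \<open>1 / Suc k\<close>.\<close>
  define tasks where "tasks = {F. finite F \<and> F \<subseteq> Q} \<times> D \<times> (UNIV :: nat set)"
  have "countable D" unfolding D_def using countable_Z by (intro countable_image countable_Diff countable_lists)
  then have "countable tasks"
    unfolding tasks_def using Q(1) by (intro countable_SIGMA countable_Collect_finite_subset) auto
  moreover have ne: "tasks \<noteq> {}" using e unfolding tasks_def by blast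
  ultimately have range: "range (from_nat_into tasks) = tasks" by (simp add: range_from_nat_into)
  define step where "step n ms us \<longleftrightarrow> us \<in> lists Z \<and> us \<noteq> [] \<and> valid \<epsilon> e (us @ ms) \<and>
    (case from_nat_into tasks n of (F, x, k) \<Rightarrow> \<forall>q\<in>F. \<bar>q (avg us) - q x\<bar> < 1 / real (Suc k))" for n ms us
  have "\<exists>ms. \<forall>n. (ms n \<in> lists Z \<and> valid \<epsilon> e (ms n)) \<and> (\<exists>us. step n (ms n) us \<and> ms (Suc n) = us @ ms n)"
  proof (rule dependent_nat_choice)
    show "\<exists>ms. ms \<in> lists Z \<and> valid \<epsilon> e ms"
      using \<epsilon> by (intro exI[of _ "[]"]) (simp add: valid_def)
  next
    fix ms n assume ms: "ms \<in> lists Z \<and> valid \<epsilon> e ms"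
    obtain F x k where task: "from_nat_into tasks n = (F, x, k)" by (cases "from_nat_into tasks n")
    then have "(F, x, k) \<in> tasks" using from_nat_into[OF ne, of n] by simp
    then have "\<exists>us\<in>lists Z. us \<noteq> [] \<and> valid \<epsilon> e (us @ ms) \<and> (\<forall>q\<in>F. \<bar>q (avg us) - q x\<bar> < 1 / real (Suc k))"
      using ms Q(2) by (intro force_average[OF e]) (auto simp: tasks_def)
    then obtain us where "step n ms us" unfolding step_def task prod.case by blast
    then show "\<exists>ms'. (ms' \<in> lists Z \<and> valid \<epsilon> e ms') \<and> (\<exists>us. step n ms us \<and> ms' = us @ ms)"
      using ms unfolding step_def by (intro exI[of _ "us @ ms"]) auto
  qed
  then obtain ms where ms': "\<forall>n. (ms n \<in> lists Z \<and> valid \<epsilon> e (ms n)) \<and> (\<exists>us. step n (ms n) us \<and> ms (Suc n) = us @ ms n)" ..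
  then have ms: "\<And>n. ms n \<in> lists Z" "\<And>n. valid \<epsilon> e (ms n)" by simp_all
  obtain us where us: "\<And>n. step n (ms n) (us n)" "\<And>n. ms (Suc n) = us n @ ms n"
    using ms' by metis
  show ?thesis
  proof (rule that[OF ms])
    fix F x and \<delta> :: real assume F: "F \<subseteq> Q" "finite F" "x \<in> D" "\<delta> > 0"
    obtain k where k: "1 / real (Suc k) < \<delta>" using F(4) nat_approx_posE by blast
    have "(F, x, k) \<in> range (from_nat_into tasks)" unfolding range using F by (simp add: tasks_def)
    then obtain n where n: "from_nat_into tasks n = (F, x, k)" by (metis imageE)
    then have "us n \<in> lists Z" "us n \<noteq> []" "\<forall>q\<in>F. \<bar>q (avg (us n)) - q x\<bar> < 1 / real (Suc k)"
      using us(1)[of n] unfolding step_def n prod.case by blast+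
    moreover have "set (us n) \<subseteq> set (ms (Suc n))" using us(2)[of n] by simp
    ultimately show "\<exists>n us. us \<in> lists Z \<and> us \<noteq> [] \<and> set us \<subseteq> set (ms n) \<and> (\<forall>q\<in>F. \<bar>q (avg us) - q x\<bar> < \<delta>)"
      using k by (intro exI[of _ "Suc n"] exI[of _ "us n"]) fastforce
  qed (simp add: us(2))
qed

text \<open>A functional norming the final position is bounded by the norm on each summand, and the
  total defect is below \<open>\<epsilon>\<close>; hence so is the defect on each single
  summand.\<close>

lemma valid_functional:
  assumes "valid \<epsilon> e ms" "ms \<in> lists Z"
  obtains f where "unit_functional f" "f e > norm e - \<epsilon>" "\<And>m. m \<in> set ms \<Longrightarrow> f (vec m) > 1 - \<epsilon>"
proof -
  obtain f where f: "unit_functional f"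
    "f (e + sum_list (map vec ms)) = norm (e + sum_list (map vec ms))"
    using norming_functional by blast
  have lin: "linear f" and le: "\<And>x. f x \<le> norm x" using f(1) by (auto simp: unit_functional_def)
  have le1: "f (vec m) \<le> 1" if "m \<in> Z" for m using le[of "vec m"] norm_vec[of m] Z_sub that by auto
  have sum: "f e + (\<Sum>m\<leftarrow>ms. f (vec m)) > norm e + real (length ms) - \<epsilon>"
    using f(2) assms(1) lin by (simp add: valid_def linear_add linear_sum_list)
  have upper: "(\<Sum>m\<leftarrow>l. f (vec m)) \<le> real (length l)" if "l \<in> lists Z" for l
    using that le1 by (induction l) force+
  have upper1: "(\<Sum>m\<leftarrow>l. f (vec m)) \<le> real (length l) - 1 + f (vec m)" if "l \<in> lists Z" "m \<in> set l" for l m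
    using that
  proof (induction l)
    case (Cons a l)
    then have "f (vec a) \<le> 1" "l \<in> lists Z" using le1 by auto
    then show ?case using Cons upper[of l] by (cases "m \<in> set l") auto
  qed auto
  show ?thesis
  proof (rule that[OF f(1)])
    show "f e > norm e - \<epsilon>" using sum upper[OF assms(2)] by simp
    show "f (vec m) > 1 - \<epsilon>" if "m \<in> set ms" for m
      using sum upper1[OF assms(2) that] le[of e] by simp
  qed
qed

text \<open>If the convex hull of the played slopes stayed \<open>\<epsilon>\<close> away from
  \<open>e\<close>, a separating functional would be low on all blocks. Their averages are
  \<open>Q\<close>-dense in \<open>D\<close>, contrary to \<open>ns\<close>. So \<open>e\<close> is
  approximated after finitely many moves, and the functional norming that position singles out one
  of them.\<close>

theorem winning_move:
  assumes e: "e \<in> D" and Q: "countable Q" "\<And>q. q \<in> Q \<Longrightarrow> bounded_linear q"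
    and ns: "\<And>f. unit_functional f \<Longrightarrow> \<not> separates_dense f Q D e \<epsilon>"
  shows "\<exists>m\<in>Z. norm (vec m + slp m) > 1 + norm e - 3 * \<epsilon>"
proof -
  obtain ms where ms: "\<And>n. ms n \<in> lists Z" "\<And>n. valid \<epsilon> e (ms n)" "\<And>n. set (ms n) \<subseteq> set (ms (Suc n))"
    and dense: "\<And>F x \<delta>. F \<subseteq> Q \<Longrightarrow> finite F \<Longrightarrow> x \<in> D \<Longrightarrow> \<delta> > 0 \<Longrightarrow>
      \<exists>n us. us \<in> lists Z \<and> us \<noteq> [] \<and> set us \<subseteq> set (ms n) \<and> (\<forall>q\<in>F. \<bar>q (avg us) - q x\<bar> < \<delta>)"
    using infinite_play[OF e Q] by blast
  have mono: "set (ms i) \<subseteq> set (ms j)" if "i \<le> j" for i j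
    using that by (induction rule: dec_induct) (use ms(3) in auto)
  define A where "A = slp ` (\<Union>n. set (ms n))"
  have "\<exists>c\<in>convex hull A. norm (e - c) < \<epsilon>"
  proof (rule ccontr)
    assume "\<not> ?thesis"
    then have far: "norm (e - c) \<ge> \<epsilon>" if "c \<in> convex hull A" for c using that by (meson not_less)
    obtain n us where "us \<noteq> []" "set us \<subseteq> set (ms n)" using dense[of "{}" e 1] e by auto
    then obtain m where "m \<in> set (ms n)" by (cases us) auto
    then have "slp m \<in> A" unfolding A_def by (intro imageI UN_I[of n]) simp_all
    then have "A \<noteq> {}" by (metis empty_iff)
    then obtain f where f: "unit_functional f" "\<And>c. c \<in> convex hull A \<Longrightarrow> f e \<ge> f c + \<epsilon>"
      using Hahn_Banach_separation[of "convex hull A" \<epsilon> e] far by auto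
    have lin: "linear f" using f(1) by (simp add: unit_functional_def)
    have "separates_dense f Q D e \<epsilon>"
      unfolding separates_dense_def
    proof (intro allI impI ballI)
      fix F x and \<delta> :: real assume F: "F \<subseteq> Q" "finite F" "x \<in> D" "\<delta> > 0"
      obtain n us where us: "us \<in> lists Z" "us \<noteq> []" "set us \<subseteq> set (ms n)" "\<forall>q\<in>F. \<bar>q (avg us) - q x\<bar> < \<delta>"
        using dense[OF F] by blast
      have "f (slp m) \<le> f e - \<epsilon>" if "m \<in> set us" for m
      proof -
        have "slp m \<in> convex hull A" using us(3) that by (intro hull_inc) (auto simp: A_def)
        then show ?thesis using f(2) by fastforce
      qed
      then have "(\<Sum>m\<leftarrow>us. f (slp m)) \<le> (\<Sum>m\<leftarrow>us. f e - \<epsilon>)" by (intro sum_list_mono)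
      then have "f (avg us) \<le> f e - \<epsilon>"
        using us(2) by (simp add: linear_avg[OF lin] sum_list_triv divide_le_eq mult.commute)
      then show "\<exists>a\<in>D. (\<forall>q\<in>F. \<bar>q a - q x\<bar> < \<delta>) \<and> f a \<le> f e - \<epsilon>"
        using us by (intro bexI[of _ "avg us"]) (auto simp: D_def)
    qed
    then show False using ns[OF f(1)] by simp
  qed
  then obtain c where c: "c \<in> convex hull A" "norm (e - c) < \<epsilon>" by blast
  obtain F where F: "finite F" "F \<subseteq> A" "c \<in> convex hull F" using convex_hull_finite_support[OF c(1)] .
  have "\<exists>n. F \<subseteq> slp ` set (ms n)" using F(1,2)
  proof (induction F rule: finite_induct)
    case (insert y F)
    then obtain n k where "F \<subseteq> slp ` set (ms n)" "y \<in> slp ` set (ms k)" by (auto simp: A_def)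
    then show ?case using mono[of n "max n k"] mono[of k "max n k"] by (intro exI[of _ "max n k"]) auto
  qed simp
  then obtain n where n: "c \<in> convex hull (slp ` set (ms n))"
    using F(3) hull_mono[of F _ convex] by blast
  obtain f where f: "unit_functional f" "f e > norm e - \<epsilon>" "\<And>m. m \<in> set (ms n) \<Longrightarrow> f (vec m) > 1 - \<epsilon>"
    using valid_functional[OF ms(2,1)] by blast
  have lin: "linear f" using f(1) by (simp add: unit_functional_def)
  have "\<exists>m\<in>set (ms n). f (slp m) \<ge> f c"
  proof (rule ccontr)
    assume "\<not> ?thesis"
    then have "slp ` set (ms n) \<subseteq> f -` {..<f c}" by auto
    moreover have "convex (f -` {..<f c})" by (intro convex_linear_vimage[OF lin]) simp
    ultimately have "convex hull (slp ` set (ms n)) \<subseteq> f -` {..<f c}" by (rule hull_minimal)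
    then show False using n by auto
  qed
  then obtain m where m: "m \<in> set (ms n)" "f (slp m) \<ge> f c" by blast
  have "f e - f c \<le> norm (e - c)"
    using f(1) by (metis lin linear_diff unit_functional_def)
  moreover have "f (vec m + slp m) \<le> norm (vec m + slp m)" using f(1) by (simp add: unit_functional_def)
  \<comment> \<open>One \<open>\<epsilon>\<close> each is lost at \<open>e\<close>, in passing from
    \<open>e\<close> to \<open>c\<close>, and at \<open>vec m\<close>.\<close>
  ultimately have "norm (vec m + slp m) > 1 + norm e - 3 * \<epsilon>"
    using c(2) f(2) f(3)[OF m(1)] m(2) by (simp add: linear_add[OF lin])
  then show ?thesis using m(1) ms(1)[of n] by auto
qed

end

lemma (in slicing_game) ex_countable_game:
  assumes "countable Z0" "Z0 \<subseteq> P" "\<epsilon> > 0"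
  shows "\<exists>Z. Z0 \<subseteq> Z \<and> countable_slicing_game P vec slp L Z \<epsilon>"
proof (rule countable_subgame[OF assms(1,2), of \<epsilon>])
  fix Z assume Z: "countable Z" "Z0 \<subseteq> Z" "Z \<subseteq> P"
    and answer: "\<And>l ms z. l \<in> lists Z \<Longrightarrow> ms \<in> lists Z \<Longrightarrow> z \<in> Z \<Longrightarrow> valid \<epsilon> (avg l) ms \<Longrightarrow>
      slp z \<in> closure (convex hull (slp ` {m\<in>Z. valid \<epsilon> (avg l) (m # ms)}))"
  have "countable_slicing_game P vec slp L Z \<epsilon>"
    by (unfold_locales; fact assms(3) Z(1) Z(3) answer)
  then show ?thesis using Z(2) by blast
qed

section \<open>Directions supplied by the alternative Daugavet property\<close>

context embedded_banach_space
begin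

lemma inj_emb: "emb x = emb y \<longleftrightarrow> x = y"
  using norm_emb[of "x - y"] emb_diff[of x y] by auto

lemma scaleK_of_real_mult: "scaleK (of_real r * c) x = r *\<^sub>R scaleK c x"
  by (metis scaleK_of_real scale_scale)

lemma scaleK_scaleR: "scaleK c (r *\<^sub>R x) = r *\<^sub>R scaleK c x"
  by (metis scaleK_of_real scale_left_commute)

lemma dual_ballI:
  assumes emb: "\<And>x. emb (g x) = u x"
    and add: "\<And>x y. u (x + y) = u x + u y" and scale: "\<And>c x. u (scaleK c x) = emb c * u x"
    and le: "\<And>x. norm (u x) \<le> norm x"
  shows "g \<in> dual_ball"
proof -
  have lin: "g (x + y) = g x + g y" "g (scaleK c x) = c * g x" for x y c
    by (simp_all add: inj_emb[symmetric] emb add scale emb_add emb_mult)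
  have norm: "norm (g x) \<le> norm x" for x using le[of x] emb[of x] norm_emb[of "g x"] by simp
  have "g (r *\<^sub>R x) = r *\<^sub>R g x" for r x
    using lin(2)[of "of_real r" x] by (simp add: scaleK_of_real scaleR_conv_of_real)
  then have "bounded_linear g"
    using lin(1) norm by (intro bounded_linear_intro[where K = 1]) auto
  moreover have "Vector_Spaces.linear scaleK (*) g"
    by unfold_locales (auto simp: lin algebra_simps)
  ultimately show ?thesis
    using norm by (simp add: dual_ball_def dual_space_def bounded_linear_over_def)
qed

text \<open>The Bohnenblust-Sobczyk passage from a real functional to a scalar one of the same norm
  bound.\<close>

lemma functional_lift:
  assumes f: "unit_functional f"
  shows "\<exists>g\<in>dual_ball. re g = f"
proof -
  have lin: "linear f" and le: "\<And>x. f x \<le> norm x" using f by (auto simp: unit_functional_def)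
  show ?thesis
    using range_emb
  proof
    assume R: "range emb = \<real>"
    then have "\<exists>k. emb k = of_real (f x)" for x by (metis Reals_of_real imageE)
    then obtain g where g: "\<And>x. emb (g x) = of_real (f x)" by metis
    have "g \<in> dual_ball"
    proof (rule dual_ballI[OF g])
      fix c x
      have "emb c \<in> \<real>" using R by auto
      then obtain r where "emb c = of_real r" by (auto elim: Reals_cases)
      then show "of_real (f (scaleK c x)) = emb c * of_real (f x)"
        using emb_of_real[of r] inj_emb[of c "of_real r"] by (simp add: scaleK_of_real linear_scale[OF lin])
    qed (use unit_functional_abs_le[OF f] in \<open>auto simp: linear_add[OF lin]\<close>)
    then show ?thesis using g by (intro bexI[of _ g]) (auto simp: re_def)
  next
    assume C: "range emb = UNIV"
    then have surj: "\<exists>k. emb k = z" for z by (metis UNIV_I imageE)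
    obtain j where j: "emb j = \<i>" using surj by blast
    have "emb (j * j) = emb (- 1)"
      using emb_diff[of 0 1] by (simp add: emb_mult j emb_zero emb_one)
    then have jj: "j * j = - 1" by (simp add: inj_emb)
    define u where "u x = Complex (f x) (- f (scaleK j x))" for x
    define g where "g x = (SOME k. emb k = u x)" for x
    have g: "emb (g x) = u x" for x
      unfolding g_def using surj by (rule someI_ex)
    have scale: "u (scaleK c x) = emb c * u x" for c x
    proof -
      define a b where "a = Re (emb c)" and "b = Im (emb c)"
      have "emb c = emb (of_real a + of_real b * j)"
        by (simp add: a_def b_def emb_add emb_mult emb_of_real j complex_eq_iff)
      then have c: "c = of_real a + of_real b * j" by (simp add: inj_emb)
      have sc1: "scaleK c x = a *\<^sub>R x + b *\<^sub>R scaleK j x"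
        unfolding c by (simp add: scale_left_distrib scaleK_of_real scaleK_of_real_mult)
      have sc2: "scaleK j (scaleK c x) = a *\<^sub>R scaleK j x - b *\<^sub>R x"
      proof -
        have "j * c = of_real a * j + of_real b * (j * j)" unfolding c by (simp add: algebra_simps)
        then have "j * c = of_real a * j - of_real b" using jj by simp
        then show ?thesis
          by (simp add: scale_left_diff_distrib scaleK_of_real scaleK_of_real_mult)
      qed
      have "f (scaleK c x) = a * f x + b * f (scaleK j x)"
        by (subst sc1) (simp add: linear_add[OF lin] linear_scale[OF lin])
      moreover have "f (scaleK j (scaleK c x)) = a * f (scaleK j x) - b * f x"
        by (subst sc2) (simp add: linear_diff[OF lin] linear_scale[OF lin])
      ultimately show ?thesis
        unfolding u_def complex_eq_iff a_def b_def by (simp del: scale_scale)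
    qed
    have "norm (u x) \<le> norm x" for x
    proof (cases "u x = 0")
      case False
      \<comment> \<open>Rotating \<open>x\<close> makes the value of \<open>u\<close> real and
        nonnegative, so that it is a value of \<open>f\<close>.\<close>
      obtain c where c: "emb c = cnj (u x) / of_real (norm (u x))" using surj by blast
      have "norm c = 1" using False norm_emb[of c] by (simp add: c norm_divide)
      have "u (scaleK c x) = of_real (norm (u x))"
        using False by (simp add: scale c complex_norm_square[symmetric] power2_eq_square mult.commute)
      then have "f (scaleK c x) = norm (u x)" by (simp add: u_def complex_eq_iff)
      then show ?thesis using le[of "scaleK c x"] \<open>norm c = 1\<close> by (simp add: norm_scaleK)
    qed simp
    then have "g \<in> dual_ball"
      by (intro dual_ballI[OF g _ scale]) (auto simp: u_def complex_eq_iff scale_right_distrib linear_add[OF lin])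
    then show ?thesis using g by (intro bexI[of _ g]) (auto simp: re_def u_def)
  qed
qed

text \<open>Rescaling one of two unit vectors enlarges the defect of their sum by at most the factor
  \<open>1 + r\<close>. For \<open>r \<ge> 1\<close> compare with
  \<open>r *\<^sub>R (y + z)\<close>, otherwise with \<open>y + z\<close>.\<close>

lemma norm_add_scaled_unit:
  fixes y z :: "'b::real_normed_vector"
  assumes y: "norm y = 1" and z: "norm z = 1" and r: "r \<ge> 0"
  shows "norm (y + r *\<^sub>R z) \<ge> r + 1 - (1 + r) * (2 - norm (y + z))"
proof -
  have d: "2 - norm (y + z) \<ge> 0" using norm_triangle_ineq[of y z] y z by simp
  show ?thesis
  proof (cases "r \<ge> 1")
    case True
    have "r *\<^sub>R (y + z) = (y + r *\<^sub>R z) + (r - 1) *\<^sub>R y" by (simp add: algebra_simps)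
    then have "r * norm (y + z) \<le> norm (y + r *\<^sub>R z) + (r - 1)"
      using norm_triangle_ineq[of "y + r *\<^sub>R z" "(r - 1) *\<^sub>R y"] True y
      by (metis (no_types, opaque_lifting) abs_of_nonneg diff_ge_0_iff_ge mult.right_neutral norm_scaleR r)
    then show ?thesis using d by (simp add: algebra_simps)
  next
    case False
    have "y + z = (y + r *\<^sub>R z) + (1 - r) *\<^sub>R z" by (simp add: algebra_simps)
    then have "norm (y + z) \<le> norm (y + r *\<^sub>R z) + norm ((1 - r) *\<^sub>R z)"
      by (metis norm_triangle_ineq)
    then have "norm (y + z) \<le> norm (y + r *\<^sub>R z) + (1 - r)" using False z by simp
    moreover have "r * (2 - norm (y + z)) \<ge> 0" using d r by simp
    ultimately show ?thesis by (simp add: algebra_simps)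
  qed
qed

lemma rank_one_tensor:
  assumes g: "g \<in> dual_ball" "g x0 \<noteq> 0" and e: "norm e = 1"
  shows "bounded_linear_over scaleK scaleK (\<lambda>x. scaleK (g x) e) \<and> rank_one scaleK (\<lambda>x. scaleK (g x) e)"
proof
  have gd: "g \<in> dual_space scaleK" "\<And>x. norm (g x) \<le> norm x" using g by (auto simp: dual_ball_def)
  have "bounded_linear g" using gd(1) by (rule dual_space_bounded_linear)
  then have "g (r *\<^sub>R x) = of_real r * g x" for r x
    by (simp add: linear_scale[OF bounded_linear.linear] scaleR_conv_of_real)
  then have "bounded_linear (\<lambda>x. scaleK (g x) e)"
    using gd(2) e
    by (intro bounded_linear_intro[where K = 1])
      (auto simp: dual_space_add[OF gd(1)] scale_left_distrib norm_scaleK scale_scale[symmetric] scaleK_of_real simp del: scale_scale)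
  moreover have "Vector_Spaces.linear scaleK scaleK (\<lambda>x. scaleK (g x) e)"
    by unfold_locales (auto simp: dual_space_add[OF gd(1)] dual_space_scale[OF gd(1)] scale_left_distrib)
  ultimately show "bounded_linear_over scaleK scaleK (\<lambda>x. scaleK (g x) e)"
    by (simp add: bounded_linear_over_def)
  have "range (\<lambda>x. scaleK (g x) e) = span {e}"
  proof -
    have "c \<in> range g" for c
    proof -
      have "g (scaleK (c / g x0) x0) = c"
        using g(2) dual_space_scale[OF gd(1), of "c / g x0" x0] by simp
      then show ?thesis by (metis rangeI)
    qed
    then have "range g = UNIV" by auto
    moreover have "range (\<lambda>x. scaleK (g x) e) = (\<lambda>k. scaleK k e) ` range g"
      by (simp only: image_image)
    ultimately show ?thesis by (simp only: span_singleton)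
  qed
  moreover have "e \<noteq> 0" using e by auto
  ultimately have "dim (range (\<lambda>x. scaleK (g x) e)) = card {e}"
    by (intro dim_eq_card) (auto simp: span_span)
  then show "rank_one scaleK (\<lambda>x. scaleK (g x) e)" by (simp add: rank_one_def)
qed

text \<open>The rotation is allowed because the alternative property yields alignment only up to a
  unit scalar.\<close>

definition aligned :: "'a \<Rightarrow> real \<Rightarrow> 'a set" where
  "aligned v \<sigma> = {y. norm y = 1 \<and> (\<exists>\<theta>. norm \<theta> = 1 \<and> norm (v + scaleK \<theta> y) > norm v + 1 - \<sigma>)}"

text \<open>Apply the property to the rank-one operator built from \<open>g\<close> and the
  direction of \<open>v\<close>. A vector at which \<open>Id + \<theta> R\<close> almost attains its
  norm must almost norm \<open>g\<close> and be aligned with a rotation of \<open>v\<close>.\<close>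

lemma aligned_near_norm:
  assumes ADP: "alternative_Daugavet_property scaleK"
    and v: "v \<noteq> 0" and g: "g \<in> dual_ball" "g x0 \<noteq> 0" and pos: "\<sigma> > 0" "\<tau> > 0" and x1: "norm x1 = 1"
  shows "\<exists>y\<in>aligned v \<sigma>. re g y > re g x1 - \<tau>"
proof -
  define e where "e = v /\<^sub>R norm v"
  have e: "norm e = 1" and v_e: "v = norm v *\<^sub>R e" using v by (auto simp: e_def)
  define R where "R x = scaleK (g x) e" for x
  have gd: "g \<in> dual_space scaleK" "\<And>x. norm (g x) \<le> norm x" using g by (auto simp: dual_ball_def)
  have R: "bounded_linear_over scaleK scaleK R" "rank_one scaleK R"
    using rank_one_tensor[OF g e] unfolding R_def by auto
  have R_bl: "bounded_linear R" using R(1) by (simp add: bounded_linear_over_def)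
  define N where "N = onorm R"
  have gN: "norm (g x) \<le> N * norm x" for x
    using onorm[OF R_bl, of x] e by (simp add: N_def R_def norm_scaleK)
  have "norm (g x0) > 0" using g(2) by simp
  then have N: "N > 0" using gN[of x0] by (smt (verit) mult_nonpos_nonneg norm_ge_zero)
  \<comment> \<open>The bounds serve, in turn, to keep \<open>c\<close> positive, to bring
    \<open>g y\<close> within \<open>\<tau>\<close> of \<open>N\<close>, and to make the alignment
    defect smaller than \<open>\<sigma>\<close>.\<close>
  define \<delta> where "\<delta> = min (N / 2) (min \<tau> (N * \<sigma> / (2 * (1 + norm v))))"
  have pv: "1 + norm v > 0" by (smt (verit) norm_ge_zero)
  have "\<delta> > 0" using N pos pv by (simp add: \<delta>_def)
  moreover have "\<delta> \<le> N / 2 \<and> \<delta> \<le> \<tau> \<and> \<delta> \<le> N * \<sigma> / (2 * (1 + norm v))"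
    unfolding \<delta>_def by (smt (verit))
  ultimately have \<delta>: "\<delta> > 0" "\<delta> \<le> N / 2" "\<delta> \<le> \<tau>" "\<delta> \<le> N * \<sigma> / (2 * (1 + norm v))"
    by blast+
  have \<delta>N: "(1 + norm v) * (\<delta> / N) < \<sigma>"
  proof -
    have "(1 + norm v) * \<delta> \<le> N * \<sigma> / 2" using \<delta>(4) pv by (simp add: field_simps)
    also have "\<dots> < N * \<sigma>" using N pos by simp
    finally show ?thesis using N by (simp add: field_simps)
  qed
  have "alternative_Daugavet_equation onorm scaleK R"
    using ADP R unfolding alternative_Daugavet_property_def by blast
  then obtain \<theta> where \<theta>: "norm \<theta> = 1" "onorm (\<lambda>x. x + scaleK \<theta> (R x)) = 1 + N"
    unfolding alternative_Daugavet_equation_def is_maximum_def N_def by auto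
  have "\<exists>x. norm (x + scaleK \<theta> (R x)) > (1 + N - \<delta>) * norm x"
  proof (rule ccontr)
    assume "\<not> ?thesis"
    then have "onorm (\<lambda>x. x + scaleK \<theta> (R x)) \<le> 1 + N - \<delta>"
      using \<delta>(2) N by (intro onorm_bound) (auto simp: not_less)
    then show False using \<theta>(2) \<delta>(1) by simp
  qed
  then obtain x where x: "norm (x + scaleK \<theta> (R x)) > (1 + N - \<delta>) * norm x" by blast
  have "x \<noteq> 0"
  proof
    assume "x = 0"
    then have "R x = 0" using R_bl by (simp add: linear_0 bounded_linear.linear)
    then show False using x \<open>x = 0\<close> by simp
  qed
  define w where "w = g x"
  define c where "c = norm w / norm x"
  have c_le: "c \<le> N" "c \<le> 1"
    using gN[of x] gd(2)[of x] \<open>x \<noteq> 0\<close> by (simp_all add: c_def w_def field_simps)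
  have "norm (x + scaleK \<theta> (R x)) \<le> norm x + norm w"
    using norm_triangle_ineq[of x "scaleK \<theta> (R x)"] \<theta>(1) e by (simp add: norm_scaleK norm_mult R_def w_def)
  also have "norm x + norm w = (1 + c) * norm x"
    using \<open>x \<noteq> 0\<close> by (simp add: c_def distrib_right)
  finally have "(1 + N - \<delta>) * norm x < (1 + c) * norm x"
    using x by linarith
  then have cN: "c > N - \<delta>" using \<open>x \<noteq> 0\<close> by simp
  then have c0: "c > 0" using \<delta>(2) N by simp
  then have "w \<noteq> 0" by (auto simp: c_def)
  \<comment> \<open>Dividing by the phase of \<open>g x\<close> makes \<open>g y\<close> the
    positive real number \<open>c\<close>.\<close>
  define \<omega> where "\<omega> = w / of_real (norm w)"
  have \<omega>: "norm \<omega> = 1" "\<omega> \<noteq> 0" using \<open>w \<noteq> 0\<close> by (auto simp: \<omega>_def norm_divide)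
  define y where "y = scaleK (inverse \<omega>) (x /\<^sub>R norm x)"
  have y: "norm y = 1" using \<omega> \<open>x \<noteq> 0\<close> by (simp add: y_def norm_scaleK norm_inverse)
  have "g (x /\<^sub>R norm x) = of_real (inverse (norm x)) * w"
    using dual_space_scale[OF gd(1), of "of_real (inverse (norm x))" x] by (simp only: scaleK_of_real w_def)
  then have gy: "g y = of_real c"
    using \<open>w \<noteq> 0\<close> by (simp add: y_def dual_space_scale[OF gd(1)] \<omega>_def c_def field_simps)
  define z where "z = scaleK \<theta> e"
  have z: "norm z = 1" using \<theta>(1) e by (simp add: z_def norm_scaleK)
  have x_y: "x = scaleK (of_real (norm x) * \<omega>) y"
  proof -
    have "of_real (norm x) * \<omega> * (inverse \<omega> * inverse (of_real (norm x)))
        = (of_real (norm x) * inverse (of_real (norm x))) * (\<omega> * inverse \<omega>)"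
      by (simp only: ac_simps)
    also have "\<dots> = 1" using \<omega>(2) \<open>x \<noteq> 0\<close> by simp
    finally have "of_real (norm x) * \<omega> * (inverse \<omega> * inverse (of_real (norm x))) = 1" .
    then show ?thesis by (simp add: y_def scaleK_of_real[symmetric])
  qed
  have "x + scaleK \<theta> (R x) = scaleK (of_real (norm x) * \<omega>) (y + c *\<^sub>R z)"
  proof -
    have "w = of_real (norm x) * \<omega> * of_real c"
      using \<open>w \<noteq> 0\<close> \<open>x \<noteq> 0\<close> by (simp add: \<omega>_def c_def)
    then have "scaleK \<theta> (R x) = scaleK (of_real (norm x) * \<omega>) (c *\<^sub>R z)"
      by (simp add: R_def w_def[symmetric] z_def scaleK_of_real[symmetric] ac_simps)
    then show ?thesis using x_y by (simp add: scale_right_distrib)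
  qed
  then have "(1 + N - \<delta>) * norm x < norm x * norm (y + c *\<^sub>R z)"
    using x \<omega> by (simp add: norm_scaleK norm_mult)
  then have yz: "norm (y + c *\<^sub>R z) > 1 + N - \<delta>" using \<open>x \<noteq> 0\<close> by (simp add: mult.commute)
  \<comment> \<open>Since \<open>c \<le> 1\<close>, the short vector \<open>c *\<^sub>R z\<close>
    can be replaced by the unit vector \<open>z\<close> in the estimate.\<close>
  have "y + c *\<^sub>R z = c *\<^sub>R (y + z) + (1 - c) *\<^sub>R y" by (simp add: algebra_simps)
  then have "norm (y + c *\<^sub>R z) \<le> c * norm (y + z) + (1 - c)"
    using norm_triangle_ineq[of "c *\<^sub>R (y + z)" "(1 - c) *\<^sub>R y"] c0 c_le y by simp
  then have "c * (2 - norm (y + z)) < c - N + \<delta>" using yz by (simp add: algebra_simps)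
  also have "\<dots> \<le> c * (\<delta> / N)"
  proof -
    have "(N - c) * (\<delta> / N) \<le> (N - c) * 1"
      using c_le(1) \<delta>(2) N by (intro mult_left_mono) (auto simp: field_simps)
    then show ?thesis using N by (simp add: field_simps)
  qed
  finally have "2 - norm (y + z) < \<delta> / N" using c0 by (simp only: mult_less_cancel_left_pos)
  then have "(1 + norm v) * (2 - norm (y + z)) < \<sigma>"
    using \<delta>N pv by (smt (verit) mult_strict_left_mono)
  \<comment> \<open>The vector \<open>norm v *\<^sub>R z\<close> is \<open>v\<close> rotated by
    \<open>\<theta>\<close>; undoing the rotation shows that \<open>y\<close> is aligned with
    \<open>v\<close>.\<close>
  then have "norm (y + norm v *\<^sub>R z) > norm v + 1 - \<sigma>"
    using norm_add_scaled_unit[OF y z, of "norm v"] by simp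
  moreover have "v + scaleK (inverse \<theta>) y = scaleK (inverse \<theta>) (y + norm v *\<^sub>R z)"
  proof -
    have "\<theta> \<noteq> 0" using \<theta>(1) by auto
    have "scaleK (inverse \<theta>) (norm v *\<^sub>R z) = v"
      using \<open>\<theta> \<noteq> 0\<close> v_e by (simp add: z_def scaleK_scaleR)
    then show ?thesis by (simp add: scale_right_distrib)
  qed
  ultimately have "y \<in> aligned v \<sigma>"
    using y \<theta>(1) by (auto simp: aligned_def norm_scaleK norm_inverse intro!: exI[of _ "inverse \<theta>"])
  moreover have "re g x1 \<le> N"
    using gN[of x1] x1 abs_Re_le_cmod[of "emb (g x1)"] by (simp add: re_def norm_emb)
  then have "re g y > re g x1 - \<tau>" using gy cN \<delta>(3) by (simp add: re_def emb_of_real)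
  ultimately show ?thesis by blast
qed

text \<open>A functional separating \<open>x\<close> from the hull would lift to the scalar dual
  ball, where aligned vectors almost reach its value at \<open>x\<close>. The norming functional of
  \<open>x\<close> first shows that aligned vectors exist.\<close>

lemma sphere_subset_hull_aligned:
  assumes ADP: "alternative_Daugavet_property scaleK" and "\<sigma> > 0" and x: "norm x = 1"
  shows "x \<in> closure (convex hull (aligned v \<sigma>))"
proof (cases "v = 0")
  case True
  have "x \<in> aligned v \<sigma>"
    using x \<open>\<sigma> > 0\<close> True by (auto simp: aligned_def intro!: exI[of _ 1])
  then show ?thesis by (meson closure_subset hull_inc subsetD)
next
  case False
  have approx: "\<exists>y\<in>aligned v \<sigma>. f y > f x - \<tau>" if f: "unit_functional f" "f \<noteq> (\<lambda>_. 0)" and \<tau>: "\<tau> > 0" for f \<tau>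
  proof -
    obtain g where g: "g \<in> dual_ball" "re g = f" using functional_lift[OF f(1)] by blast
    obtain x0 where "f x0 \<noteq> 0" using f(2) by auto
    then have "g x0 \<noteq> 0" using g(2) by (auto simp: re_def emb_zero)
    then show ?thesis using aligned_near_norm[OF ADP False g(1) _ \<open>\<sigma> > 0\<close> \<tau> x] g(2) by blast
  qed
  obtain h where h: "unit_functional h" "h x = norm x" using norming_functional by blast
  then have "h \<noteq> (\<lambda>_. 0)" using x by auto
  then have ne: "aligned v \<sigma> \<noteq> {}" using approx[OF h(1), of 1] by auto
  show ?thesis
  proof (rule ccontr)
    assume "x \<notin> closure (convex hull (aligned v \<sigma>))"
    then obtain f \<epsilon> where f: "unit_functional f" "\<epsilon> > 0" "\<And>s. s \<in> convex hull (aligned v \<sigma>) \<Longrightarrow> f x \<ge> f s + \<epsilon>"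
      using closure_convex_separation[of "convex hull (aligned v \<sigma>)" x] ne by auto
    have fs: "f x \<ge> f s + \<epsilon>" if "s \<in> aligned v \<sigma>" for s using f(3) that hull_inc by metis
    then have "f \<noteq> (\<lambda>_. 0)" using ne f(2) by fastforce
    then show False using approx[OF f(1) _ f(2)] fs by fastforce
  qed
qed

end

section \<open>Lipschitz maps as slicing games\<close>

text \<open>The directions whose increment quotients all lie in \<open>K\<close> form a closed
  convex set: a step along a convex combination is two consecutive steps, and its quotient is the
  same convex combination of theirs. Continuity of \<open>T\<close> gives closedness.\<close>

lemma increment_quotient_mem:
  fixes T :: "'a::real_normed_vector \<Rightarrow> 'b::real_normed_vector"
  assumes T: "continuous_on UNIV T" and K: "closed K" "convex K"
    and A: "\<And>a p c. a \<in> A \<Longrightarrow> c > 0 \<Longrightarrow> (T (p + c *\<^sub>R a) - T p) /\<^sub>R c \<in> K"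
    and h: "h \<in> closure (convex hull A)" and c: "c > 0"
  shows "(T (p + c *\<^sub>R h) - T p) /\<^sub>R c \<in> K"
proof -
  define V where "V = {v. \<forall>p. \<forall>c>0. (T (p + c *\<^sub>R v) - T p) /\<^sub>R c \<in> K}"
  have "convex V"
    unfolding convex_def
  proof (intro ballI allI impI)
    fix u w and a b :: real assume uw: "u \<in> V" "w \<in> V" and ab: "a \<ge> 0" "b \<ge> 0" "a + b = 1"
    show "a *\<^sub>R u + b *\<^sub>R w \<in> V"
    proof (cases "a = 0 \<or> b = 0")
      case True
      then show ?thesis using uw ab by auto
    next
      case False
      then have pos: "a > 0" "b > 0" using ab by auto
      show ?thesis unfolding V_def
      proof (intro CollectI allI impI)
        fix p and c :: real assume c: "c > 0"
        let ?q = "p + (c * b) *\<^sub>R w"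
        have K1: "(T (?q + (c * a) *\<^sub>R u) - T ?q) /\<^sub>R (c * a) \<in> K"
          using uw(1) mult_pos_pos[OF c pos(1)] unfolding V_def by blast
        have K2: "(T ?q - T p) /\<^sub>R (c * b) \<in> K"
          using uw(2) mult_pos_pos[OF c pos(2)] unfolding V_def by blast
        have eq: "p + c *\<^sub>R (a *\<^sub>R u + b *\<^sub>R w) = ?q + (c * a) *\<^sub>R u" by (simp add: algebra_simps)
        have "(T (p + c *\<^sub>R (a *\<^sub>R u + b *\<^sub>R w)) - T p) /\<^sub>R c
            = (T (?q + (c * a) *\<^sub>R u) - T ?q) /\<^sub>R c + (T ?q - T p) /\<^sub>R c"
          unfolding eq by (simp add: scaleR_right_diff_distrib)
        also have "\<dots> = a *\<^sub>R ((T (?q + (c * a) *\<^sub>R u) - T ?q) /\<^sub>R (c * a)) + b *\<^sub>R ((T ?q - T p) /\<^sub>R (c * b))"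
        proof -
          have "a * inverse (c * a) = inverse c" "b * inverse (c * b) = inverse c"
            using pos by (simp_all add: field_simps)
          then show ?thesis by (simp only: scaleR_scaleR)
        qed
        also have "\<dots> \<in> K" using K(2) K1 K2 ab by (rule convexD)
        finally show "(T (p + c *\<^sub>R (a *\<^sub>R u + b *\<^sub>R w)) - T p) /\<^sub>R c \<in> K" .
      qed
    qed
  qed
  moreover have "closed V"
  proof -
    have V: "V = (\<Inter>p. \<Inter>c\<in>{0<..}. (\<lambda>v. (T (p + c *\<^sub>R v) - T p) /\<^sub>R c) -` K)"
      by (auto simp: V_def)
    have "closed ((\<lambda>v. (T (p + c *\<^sub>R v) - T p) /\<^sub>R c) -` K)" for p c
    proof (rule closed_vimage[OF K(1)])
      show "continuous_on UNIV (\<lambda>v. (T (p + c *\<^sub>R v) - T p) /\<^sub>R c)"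
        by (intro continuous_intros continuous_on_compose2[OF T]) auto
    qed
    then show ?thesis unfolding V by auto
  qed
  moreover have "A \<subseteq> V" using A by (auto simp: V_def)
  ultimately have "closure (convex hull A) \<subseteq> V" by (intro closure_minimal hull_minimal)
  then show ?thesis using h c unfolding V_def by blast
qed

locale lipschitz_map = embedded_banach_space scaleK emb
  for scaleK :: "'k::real_or_complex_field \<Rightarrow> 'a::banach \<Rightarrow> 'a" and emb +
  fixes T :: "'a \<Rightarrow> 'a" and L :: real
  assumes ADP: "alternative_Daugavet_property scaleK" and lipschitz: "L-lipschitz_on UNIV T"
begin

text \<open>The rotation \<open>\<theta>\<close> is part of a move, so that countably many moves admit only countably many positions.\<close>

definition moves :: "('k \<times> 'a \<times> 'a) set" where
  "moves = {(\<theta>, x, y). norm \<theta> = 1 \<and> x \<noteq> y}"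

definition vec :: "'k \<times> 'a \<times> 'a \<Rightarrow> 'a" where
  "vec = (\<lambda>(\<theta>, x, y). scaleK \<theta> ((x - y) /\<^sub>R norm (x - y)))"

definition slp :: "'k \<times> 'a \<times> 'a \<Rightarrow> 'a" where
  "slp = (\<lambda>(\<theta>, x, y). (T x - T y) /\<^sub>R norm (x - y))"

lemma slope_eq: "slope T = slp ` moves"
proof -
  have "(T x - T y) /\<^sub>R norm (x - y) \<in> slp ` moves" if "x \<noteq> y" for x y
    using that by (intro image_eqI[of _ _ "(1, x, y)"]) (auto simp: slp_def moves_def)
  then show ?thesis by (auto simp: slope_def slp_def moves_def)
qed

text \<open>For \<open>answer\<close>, the direction of a pair lies in the closed convex hull of the
  aligned directions. Quotients along aligned directions are slopes of legal moves, and
  \<open>increment_quotient_mem\<close> carries this over to the given pair.\<close>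

sublocale slicing_game moves vec slp L
proof
  fix m assume "m \<in> moves"
  then obtain \<theta> x y where m: "m = (\<theta>, x, y)" "norm \<theta> = 1" "x \<noteq> y" by (auto simp: moves_def)
  then show "norm (vec m) = 1" by (simp add: vec_def norm_scaleK)
  show "norm (slp m) \<le> L"
  proof -
    have "norm (slp m) = norm (T x - T y) / norm (x - y)"
      by (simp add: slp_def m(1) divide_inverse mult.commute)
    then show ?thesis
      using lipschitz_onD[OF lipschitz, of x y] m(3) by (simp add: dist_norm divide_le_eq)
  qed
next
  fix m v and \<sigma> :: real assume "m \<in> moves" and \<sigma>: "\<sigma> > 0"
  then obtain \<theta> x y where m: "m = (\<theta>, x, y)" "norm \<theta> = 1" "x \<noteq> y" by (auto simp: moves_def)
  define h where "h = (x - y) /\<^sub>R norm (x - y)"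
  define K where "K = closure (convex hull (slp ` {m'\<in>moves. norm (v + vec m') > norm v + 1 - \<sigma>}))"
  have "(T (y + norm (x - y) *\<^sub>R h) - T y) /\<^sub>R norm (x - y) \<in> K"
  proof (rule increment_quotient_mem)
    show "continuous_on UNIV T" using lipschitz by (rule lipschitz_on_continuous_on)
    show "h \<in> closure (convex hull (aligned v \<sigma>))"
      using m(3) by (intro sphere_subset_hull_aligned[OF ADP \<sigma>]) (simp add: h_def)
    fix a p and c :: real assume a: "a \<in> aligned v \<sigma>" and c: "c > 0"
    obtain \<theta>' where \<theta>': "norm \<theta>' = 1" "norm (v + scaleK \<theta>' a) > norm v + 1 - \<sigma>" and na: "norm a = 1"
      using a by (auto simp: aligned_def)
    define m' where "m' = (\<theta>', p + c *\<^sub>R a, p)"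
    have "a \<noteq> 0" using na by auto
    then have "m' \<in> moves" "vec m' = scaleK \<theta>' a" "slp m' = (T (p + c *\<^sub>R a) - T p) /\<^sub>R c"
      using \<theta>'(1) c na by (auto simp: m'_def moves_def vec_def slp_def)
    then have "(T (p + c *\<^sub>R a) - T p) /\<^sub>R c \<in> slp ` {m'\<in>moves. norm (v + vec m') > norm v + 1 - \<sigma>}"
      using \<theta>'(2) by (intro image_eqI[of _ _ m']) auto
    then show "(T (p + c *\<^sub>R a) - T p) /\<^sub>R c \<in> K"
      unfolding K_def by (meson closure_subset hull_inc subsetD)
  qed (use m(3) in \<open>auto simp: K_def convex_closure\<close>)
  moreover have "y + norm (x - y) *\<^sub>R h = x" using m(3) by (simp add: h_def)
  ultimately show "slp m \<in> closure (convex hull (slp ` {m'\<in>moves. norm (v + vec m') > norm v + 1 - \<sigma>}))"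
    by (simp add: K_def m(1) slp_def)
qed

end

section \<open>Lipschitz maps with small slope sets\<close>

context countable_slicing_game
begin

lemma slp_mem_D: "z \<in> Z \<Longrightarrow> slp z \<in> D"
  unfolding D_def by (intro image_eqI[of _ _ "[z]"]) (auto simp: avg_def)

lemma countable_D: "countable D"
  unfolding D_def using countable_Z by (intro countable_image countable_Diff countable_lists)

lemma D_subset_hull: "D \<subseteq> convex hull (slp ` Z)"
proof
  fix x assume "x \<in> D"
  then obtain l where l: "l \<in> lists Z" "l \<noteq> []" "x = avg l" by (auto simp: D_def)
  have "x = (\<Sum>i<length l. (1 / real (length l)) *\<^sub>R slp (l ! i))"
    by (simp add: l(3) avg_def sum_list_sum_nth scaleR_sum_right atLeast0LessThan)
  also have "\<dots> \<in> convex hull (slp ` Z)"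
    using l by (intro convex_sum) (auto intro!: hull_inc)
  finally show "x \<in> convex hull (slp ` Z)" .
qed

lemma norm_D: "x \<in> D \<Longrightarrow> norm x \<le> L"
proof -
  assume x: "x \<in> D"
  have "convex hull (slp ` Z) \<subseteq> cball 0 L"
    using norm_slp Z_sub by (intro hull_minimal) auto
  then show ?thesis using D_subset_hull x by auto
qed

lemma rational_combination_mem_D:
  assumes "x \<in> D" "y \<in> D" "n > 0" "i \<le> n"
  shows "(real i / real n) *\<^sub>R x + (real (n - i) / real n) *\<^sub>R y \<in> D"
proof -
  obtain l l' where l: "l \<in> lists Z" "l \<noteq> []" "x = avg l" and l': "l' \<in> lists Z" "l' \<noteq> []" "y = avg l'"
    using assms(1,2) by (auto simp: D_def)
  define rep where "rep k l = concat (replicate k l)" for k and l :: "'m list"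
  have len: "length (rep k l) = k * length l" for k l by (induction k) (auto simp: rep_def)
  have sum: "sum_list (map slp (rep k l)) = real k *\<^sub>R sum_list (map slp l)" for k l
    by (induction k) (auto simp: rep_def algebra_simps)
  have rep: "rep k l \<in> lists Z" if "l \<in> lists Z" for k l
    using that by (induction k) (auto simp: rep_def)
  define a b where "a = length l" and "b = length l'"
  have ab: "a > 0" "b > 0" using l l' by (auto simp: a_def b_def)
  \<comment> \<open>The repetitions equalise the lengths \<open>a\<close> and \<open>b\<close>, so
    that the weights become \<open>i / n\<close> and \<open>(n - i) / n\<close>.\<close>
  define w where "w = rep (i * b) l @ rep ((n - i) * a) l'"
  have len_w: "length w = n * a * b"
  proof -
    have "length w = (i + (n - i)) * a * b" by (simp add: w_def len a_def b_def algebra_simps)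
    then show ?thesis using assms(4) by simp
  qed
  have "avg w = (1 / real (n * a * b)) *\<^sub>R (real (i * b) *\<^sub>R sum_list (map slp l)
      + real ((n - i) * a) *\<^sub>R sum_list (map slp l'))"
    unfolding avg_def len_w by (simp add: w_def sum)
  also have "\<dots> = (real i / real n) *\<^sub>R x + (real (n - i) / real n) *\<^sub>R y"
    using ab assms(3) unfolding l(3) l'(3) avg_def a_def[symmetric] b_def[symmetric]
    by (simp add: scaleR_add_right)
  finally have "avg w = (real i / real n) *\<^sub>R x + (real (n - i) / real n) *\<^sub>R y" .
  moreover have "w \<in> lists Z - {[]}"
    using rep[OF l(1)] rep[OF l'(1)] ab assms(3) len_w by (auto simp: w_def)
  ultimately show ?thesis unfolding D_def by (metis imageI)
qed

text \<open>\<open>D\<close> itself has only rational convex combinations; real weights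
  \<open>t\<close> are approximated by \<open>i / n\<close> with \<open>i\<close> the floor of
  \<open>t * n\<close>.\<close>

lemma convex_closure_D: "convex (closure D)"
proof -
  have D: "t *\<^sub>R x + (1 - t) *\<^sub>R y \<in> closure D" if xy: "x \<in> D" "y \<in> D" and t: "0 \<le> t" "t \<le> 1" for x y t
    unfolding closure_approachable
  proof (intro allI impI)
    fix r :: real assume r: "r > 0"
    obtain n where n: "real n > norm (x - y) / r" using reals_Archimedean2 by blast
    then have n0: "n > 0" using r by (metis divide_nonneg_pos gr0I norm_ge_zero not_less of_nat_0)
    define i where "i = nat \<lfloor>t * real n\<rfloor>"
    have i: "real i \<le> t * real n" "t * real n < real i + 1"
      using t unfolding i_def by (simp_all add: of_nat_nat floor_less_iff)
    have "t * real n \<le> real n" using t by (simp add: mult_left_le_one_le)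
    then have "i \<le> n" using i by linarith
    define s where "s = real i / real n"
    have "s - t = (real i - t * real n) / real n" using n0 by (simp add: s_def diff_divide_distrib)
    moreover have "\<bar>real i - t * real n\<bar> \<le> 1" using i by linarith
    ultimately have s: "\<bar>s - t\<bar> \<le> 1 / real n" by (simp add: divide_right_mono)
    have "s *\<^sub>R x + (1 - s) *\<^sub>R y \<in> D"
      using rational_combination_mem_D[OF xy n0 \<open>i \<le> n\<close>] \<open>i \<le> n\<close> n0
      by (simp add: s_def of_nat_diff diff_divide_distrib)
    moreover have "dist (s *\<^sub>R x + (1 - s) *\<^sub>R y) (t *\<^sub>R x + (1 - t) *\<^sub>R y) < r"
    proof -
      have "(s *\<^sub>R x + (1 - s) *\<^sub>R y) - (t *\<^sub>R x + (1 - t) *\<^sub>R y) = (s - t) *\<^sub>R (x - y)"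
        by (simp add: algebra_simps)
      then have "dist (s *\<^sub>R x + (1 - s) *\<^sub>R y) (t *\<^sub>R x + (1 - t) *\<^sub>R y) = \<bar>s - t\<bar> * norm (x - y)"
        by (simp add: dist_norm)
      also have "\<dots> \<le> (1 / real n) * norm (x - y)" using s by (intro mult_right_mono) auto
      also have "\<dots> < r" using n n0 r by (simp add: field_simps)
      finally show ?thesis .
    qed
    ultimately show "\<exists>z\<in>D. dist z (t *\<^sub>R x + (1 - t) *\<^sub>R y) < r" by blast
  qed
  show ?thesis
    unfolding convex_alt
  proof (intro ballI allI impI)
    fix x y and t :: real assume xy: "x \<in> closure D" "y \<in> closure D" and t: "0 \<le> t \<and> t \<le> 1"
    obtain u v where u: "\<And>n. u n \<in> D" "u \<longlonglongrightarrow> x" and v: "\<And>n. v n \<in> D" "v \<longlonglongrightarrow> y"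
      using xy unfolding closure_sequential by blast
    have lim: "(\<lambda>n. (1 - t) *\<^sub>R u n + t *\<^sub>R v n) \<longlonglongrightarrow> (1 - t) *\<^sub>R x + t *\<^sub>R y"
      by (intro tendsto_intros u v)
    have "(1 - t) *\<^sub>R u n + t *\<^sub>R v n \<in> closure D" for n
      using D[OF u(1) v(1), of "1 - t"] t by simp
    then show "(1 - t) *\<^sub>R x + t *\<^sub>R y \<in> closure D"
      using closed_sequentially[OF closed_closure _ lim] by simp
  qed
qed

lemma closure_hull_subset_closure_D: "closure (convex hull (slp ` Z)) \<subseteq> closure D"
proof -
  have "slp ` Z \<subseteq> closure D" using slp_mem_D closure_subset by blast
  then have "convex hull (slp ` Z) \<subseteq> closure D" by (intro hull_minimal convex_closure_D)
  then show ?thesis by (intro closure_minimal) auto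
qed

text \<open>On a neighbourhood of \<open>e\<close> that is small in norm, a functional of norm at
  most one cannot drop by \<open>\<epsilon>\<close>.\<close>

lemma not_separates_dense_if_local:
  assumes f: "unit_functional f" and F: "finite F" "F \<subseteq> Q" and e: "e \<in> D" and \<delta>: "\<delta> > 0"
    and loc: "\<And>a. a \<in> D \<Longrightarrow> (\<And>q. q \<in> F \<Longrightarrow> \<bar>q a - q e\<bar> < \<delta>) \<Longrightarrow> norm (a - e) < \<epsilon>"
  shows "\<not> separates_dense f Q D e \<epsilon>"
proof
  assume "separates_dense f Q D e \<epsilon>"
  then obtain a where a: "a \<in> D" "\<And>q. q \<in> F \<Longrightarrow> \<bar>q a - q e\<bar> < \<delta>" "f a \<le> f e - \<epsilon>"
    using separates_denseD[OF _ F(2,1) e \<delta>] by blast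
  have "\<bar>f (a - e)\<bar> \<le> norm (a - e)" using f by (rule unit_functional_abs_le)
  moreover have "f (a - e) = f a - f e" using f by (simp add: unit_functional_def linear_diff)
  ultimately show False using loc[OF a(1,2)] a(3) by linarith
qed

text \<open>The truncation of the slope set at height \<open>a\<close> has a small relatively weakly open set. It may lie
  in the face \<open>{f0 = a}\<close>, but a small move towards \<open>z0\<close> brings its points strictly above \<open>a\<close>.\<close>

lemma small_weak_neighbourhood:
  fixes F :: "('a \<Rightarrow> real) set"
  assumes f0: "unit_functional f0" and z0: "z0 \<in> Z" "f0 (slp z0) > a"
    and x: "x \<in> closure (convex hull (slp ` Z))" "f0 x \<ge> a"
    and F: "finite F" "\<And>q. q \<in> F \<Longrightarrow> bounded_linear q" and \<delta>: "\<delta> > 0"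
    and loc: "\<And>y. y \<in> closure (convex hull (slp ` Z)) \<Longrightarrow> f0 y \<ge> a \<Longrightarrow>
      (\<And>q. q \<in> F \<Longrightarrow> \<bar>q y - q x\<bar> < \<delta>) \<Longrightarrow> norm (y - x) < \<epsilon> / 2"
  shows "\<exists>e\<in>D. norm e > a \<and> (\<exists>Q. countable Q \<and> (\<forall>q\<in>Q. bounded_linear q) \<and>
    (\<forall>f. unit_functional f \<longrightarrow> \<not> separates_dense f Q D e \<epsilon>))"
proof -
  let ?K = "closure (convex hull (slp ` Z))"
  have f0_bl: "bounded_linear f0" using f0 by (rule unit_functional_bounded_linear)
  have lin: "linear f0" using f0 by (simp add: unit_functional_def)
  define W where "W = (\<Inter>q\<in>F. {y. \<bar>q y - q x\<bar> < \<delta>})"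
  have "open {y. \<bar>q y - q x\<bar> < \<delta>}" if "q \<in> F" for q
  proof -
    have "continuous_on UNIV q" using F(2)[OF that] by (rule linear_continuous_on)
    then show ?thesis by (intro open_Collect_less continuous_intros)
  qed
  then have W: "open W" "x \<in> W" using F(1) \<delta> by (auto simp: W_def)
  \<comment> \<open>The strict inequality makes \<open>U\<close> open, so \<open>U\<close> meets
    \<open>D\<close> as soon as it meets the closure of \<open>D\<close>.\<close>
  define U where "U = W \<inter> {y. f0 y > a}"
  have "open {y. f0 y > a}"
    using linear_continuous_on[OF f0_bl, of UNIV] by (intro open_Collect_less continuous_intros)
  then have U: "open U" using W(1) by (simp add: U_def open_Int)
  obtain r where r: "r > 0" "ball x r \<subseteq> W" using W openE by blast
  \<comment> \<open>This moves \<open>x\<close> by less than \<open>r\<close>; the summand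
    \<open>1\<close> keeps the denominator positive.\<close>
  define t where "t = min 1 (r / (2 * (norm (slp z0 - x) + 1)))"
  have n1: "norm (slp z0 - x) + 1 > 0" by (smt (verit) norm_ge_zero)
  have t: "t > 0" "t \<le> 1" using r(1) n1 by (auto simp: t_def)
  define x' where "x' = (1 - t) *\<^sub>R x + t *\<^sub>R slp z0"
  have zK: "slp z0 \<in> ?K" using z0(1) by (meson closure_subset hull_inc imageI subsetD)
  have "x' \<in> ?K"
    using t x(1) zK unfolding x'_def by (intro convexD[OF convex_closure]) auto
  then have "x' \<in> closure D" using closure_hull_subset_closure_D by blast
  moreover have "x' \<in> U"
  proof -
    have "t * norm (slp z0 - x) < r"
    proof -
      have "t * norm (slp z0 - x) \<le> r / (2 * (norm (slp z0 - x) + 1)) * norm (slp z0 - x)"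
        unfolding t_def by (intro mult_right_mono) auto
      also have "\<dots> \<le> r / 2" using n1 r(1) by (simp add: field_simps)
      finally show ?thesis using r(1) by simp
    qed
    moreover have "x' - x = t *\<^sub>R (slp z0 - x)" by (simp add: x'_def algebra_simps)
    ultimately have "x' \<in> ball x r" using t by (simp add: dist_norm norm_minus_commute[of x])
    moreover have "f0 x' > a"
    proof -
      have "f0 x' = (1 - t) * f0 x + t * f0 (slp z0)"
        by (simp add: x'_def linear_add[OF lin] linear_scale[OF lin])
      moreover have "(1 - t) * f0 x \<ge> (1 - t) * a" using t x(2) by (intro mult_left_mono) auto
      moreover have "t * f0 (slp z0) > t * a" using t z0(2) by simp
      ultimately show ?thesis by (simp add: algebra_simps)
    qed
    ultimately show ?thesis using r(2) by (auto simp: U_def)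
  qed
  ultimately have "U \<inter> D \<noteq> {}"
    using open_Int_closure_eq_empty[OF U, of D] by blast
  then obtain e where e: "e \<in> D" "e \<in> W" "f0 e > a" by (auto simp: U_def)
  \<comment> \<open>The least slack that \<open>e\<close> has in the constraints, the height
    \<open>a\<close> included, so that nearby points of \<open>D\<close> satisfy them as
    well.\<close>
  define \<delta>' where "\<delta>' = Min (insert (f0 e - a) ((\<lambda>q. \<delta> - \<bar>q e - q x\<bar>) ` F))"
  have \<delta>': "\<delta>' > 0" using e F(1) by (auto simp: \<delta>'_def W_def)
  have \<delta>'_le: "\<delta>' \<le> f0 e - a" "\<And>q. q \<in> F \<Longrightarrow> \<delta>' \<le> \<delta> - \<bar>q e - q x\<bar>"
    using F(1) unfolding \<delta>'_def by (auto intro!: Min_le)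
  have DK: "D \<subseteq> ?K" using D_subset_hull closure_subset by blast
  have near: "norm (y - e) < \<epsilon>" if y: "y \<in> D" "\<And>q. q \<in> insert f0 F \<Longrightarrow> \<bar>q y - q e\<bar> < \<delta>'" for y
  proof -
    have "f0 y \<ge> a" using y(2)[of f0] \<delta>'_le(1) by auto
    moreover have "\<bar>q y - q x\<bar> < \<delta>" if "q \<in> F" for q
      using y(2)[of q] \<delta>'_le(2)[OF that] that by auto
    ultimately have "norm (y - x) < \<epsilon> / 2" using y(1) DK by (intro loc) auto
    moreover have "norm (e - x) < \<epsilon> / 2" using e DK by (intro loc) (auto simp: W_def)
    ultimately show ?thesis using norm_triangle_ineq4[of "y - x" "e - x"] by simp
  qed
  have "f0 e \<le> norm e" using f0 by (simp add: unit_functional_def)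
  then have "norm e > a" using e(3) by simp
  moreover have "\<not> separates_dense f (insert f0 F) D e \<epsilon>" if "unit_functional f" for f
    using F(1) by (intro not_separates_dense_if_local[OF that _ subset_refl e(1) \<delta>' near]) auto
  moreover have "countable (insert f0 F)" "\<forall>q\<in>insert f0 F. bounded_linear q"
    using F f0_bl by (auto simp: countable_finite)
  ultimately show ?thesis using e(1) by blast
qed

end

context embedded_banach_space
begin

text \<open>Induction on the generation of the topology. In the basic case the real and imaginary
  parts control a scalar value, so finitely many real functionals suffice.\<close>

lemma weakly_open_nbhd:
  assumes "openin (weak_topology scaleK) S" "x \<in> S"
  shows "\<exists>F \<delta>. finite F \<and> (\<forall>q\<in>F. bounded_linear q) \<and> \<delta> > (0::real) \<and>
    (\<forall>y. (\<forall>q\<in>F. \<bar>q y - q x\<bar> < \<delta>) \<longrightarrow> y \<in> S)"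
proof -
  have "generate_topology_on {f -` U | f U. f \<in> dual_space scaleK \<and> open U} S"
    using assms(1) unfolding weak_topology_def by (rule openin_topology_generated_by)
  then show ?thesis using assms(2)
  proof (induction rule: generate_topology_on.induct)
    case (Int a b)
    obtain F :: "('a \<Rightarrow> real) set" and \<delta> :: real where F: "finite F" "\<forall>q\<in>F. bounded_linear q" "\<delta> > 0"
        "\<forall>y. (\<forall>q\<in>F. \<bar>q y - q x\<bar> < \<delta>) \<longrightarrow> y \<in> a"
      using Int.IH(1) Int.prems by blast
    obtain F' :: "('a \<Rightarrow> real) set" and \<delta>' :: real where F': "finite F'" "\<forall>q\<in>F'. bounded_linear q" "\<delta>' > 0"
        "\<forall>y. (\<forall>q\<in>F'. \<bar>q y - q x\<bar> < \<delta>') \<longrightarrow> y \<in> b"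
      using Int.IH(2) Int.prems by blast
    show ?case
      by (rule exI[of _ "F \<union> F'"], rule exI[of _ "min \<delta> \<delta>'"]) (use F F' in auto)
  next
    case (UN K)
    then obtain k where "k \<in> K" "x \<in> k" by blast
    then show ?case using UN.IH[of k] by blast
  next
    case (Basis s)
    then obtain f U where s: "s = f -` U" "f \<in> dual_space scaleK" "open U" by blast
    then obtain r where r: "r > 0" "ball (f x) r \<subseteq> U" using Basis openE by blast
    have "y \<in> s" if "\<forall>q\<in>{re f, im f}. \<bar>q y - q x\<bar> < r / 2" for y
    proof -
      have "norm (emb (f y) - emb (f x)) \<le> \<bar>re f y - re f x\<bar> + \<bar>im f y - im f x\<bar>"
        using cmod_le[of "emb (f y) - emb (f x)"] by (simp add: re_def im_def)
      also have "\<dots> < r" using that by auto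
      finally have "dist (f x) (f y) < r"
        by (simp add: emb_diff[symmetric] norm_emb dist_norm norm_minus_commute)
      then show ?thesis using r(2) s(1) by auto
    qed
    then show ?case using r(1) s(2) re_bounded_linear im_bounded_linear
      by (intro exI[of _ "{re f, im f}"] exI[of _ "r / 2"]) auto
  qed auto
qed

end

section \<open>From the four properties to the attained maximum\<close>

lemma lip_norm_upper:
  assumes "L-lipschitz_on UNIV T" "x \<noteq> y"
  shows "norm (T x - T y) / norm (x - y) \<le> lip_norm T"
  unfolding lip_norm_def
proof (rule cSup_upper)
  show "bdd_above {norm (T x1 - T x2) / norm (x1 - x2) |x1 x2. x1 \<noteq> x2}"
    using lipschitz_onD[OF assms(1)]
    by (intro bdd_aboveI[of _ L]) (auto simp: divide_le_eq dist_norm)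
qed (use assms(2) in auto)

lemma lip_norm_least:
  fixes T :: "'a::real_normed_vector \<Rightarrow> 'a"
  assumes "\<exists>x::'a. x \<noteq> 0" "\<And>x y. x \<noteq> y \<Longrightarrow> norm (T x - T y) / norm (x - y) \<le> c"
  shows "lip_norm T \<le> c"
  unfolding lip_norm_def using assms by (intro cSup_least) auto

context lipschitz_map
begin

text \<open>Each property supplies an \<open>e\<close> of norm above \<open>a\<close> and a
  countable \<open>Q\<close> for \<open>winning_move\<close>. RNP and CPCP give a small piece of a
  truncated slope hull; the other two use the slope of \<open>z0\<close> as
  \<open>e\<close>.\<close>

lemma winning_move_if:
  assumes nontriv: "\<exists>x::'a. x \<noteq> 0" and \<epsilon>: "\<epsilon> > 0"
    and props: "Radon_Nikodym_property (closure (convex hull (slope T))) \<or>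
         Asplund_property scaleK (closure (convex hull (slope T))) \<or>
         convex_point_of_continuity_property scaleK (closure (convex hull (slope T))) \<or>
         no_l1_sequences scaleK (closure (convex hull (slope T)))"
  shows "\<exists>m\<in>moves. norm (vec m + slp m) > 1 + lip_norm T - 4 * \<epsilon>"
proof -
  define C where "C = closure (convex hull (slope T))"
  define a where "a = lip_norm T - \<epsilon>"
  have "\<exists>z0\<in>moves. norm (slp z0) > a"
  proof (rule ccontr)
    assume no: "\<not> ?thesis"
    have "norm (T x - T y) / norm (x - y) \<le> a" if "x \<noteq> y" for x y
    proof -
      have "(1, x, y) \<in> moves" using that by (simp add: moves_def)
      then have "norm (slp (1, x, y)) \<le> a" using no by (meson not_less)
      then show ?thesis by (simp add: slp_def divide_inverse mult.commute)
    qed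
    then have "lip_norm T \<le> a" using nontriv by (intro lip_norm_least) auto
    then show False using \<epsilon> by (simp add: a_def)
  qed
  then obtain z0 where z0: "z0 \<in> moves" "norm (slp z0) > a" by blast
  obtain Z where z0Z: "z0 \<in> Z" and "countable_slicing_game moves vec slp L Z \<epsilon>"
    using ex_countable_game[of "{z0}" \<epsilon>] z0(1) \<epsilon> by auto
  then interpret game: countable_slicing_game moves vec slp L Z \<epsilon> by simp
  note Z = game.countable_Z game.Z_sub
  let ?K = "closure (convex hull (slp ` Z))"
  have slpZ: "slp ` Z \<subseteq> slope T" using Z(2) by (auto simp: slope_eq)
  have KC: "?K \<subseteq> C" unfolding C_def using slpZ by (intro closure_mono hull_mono)
  have bounded: "bounded C"
  proof -
    have "convex hull (slope T) \<subseteq> cball 0 L"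
      using norm_slp by (intro hull_minimal) (auto simp: slope_eq)
    then show ?thesis unfolding C_def using bounded_cball bounded_subset by (intro bounded_closure) blast
  qed
  have DC: "game.D \<subseteq> C" using game.D_subset_hull KC closure_subset by blast
  obtain f0 where f0: "unit_functional f0" "f0 (slp z0) = norm (slp z0)" using norming_functional by blast
  have lin0: "linear f0" using f0(1) by (simp add: unit_functional_def)
  \<comment> \<open>The truncation forces every point of the small piece to have norm at least
    \<open>a\<close>.\<close>
  define D0 where "D0 = ?K \<inter> {y. f0 y \<ge> a}"
  have D0: "D0 \<subseteq> C" "D0 \<noteq> {}" "closed D0" "convex D0"
  proof -
    show "D0 \<subseteq> C" using KC by (auto simp: D0_def)
    have "slp z0 \<in> ?K" using z0Z by (meson closure_subset hull_inc imageI subsetD)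
    then show "D0 \<noteq> {}" using f0(2) z0(2) by (auto simp: D0_def intro: less_imp_le)
    have "closed {y. f0 y \<ge> a}"
      using linear_continuous_on[OF unit_functional_bounded_linear[OF f0(1)], of UNIV]
      by (intro closed_Collect_le continuous_intros)
    then show "closed D0" by (simp add: D0_def closed_Int)
    have "convex {y. f0 y \<ge> a}"
      using convex_linear_vimage[OF lin0, of "{a..}"] by (simp add: vimage_def)
    then show "convex D0" unfolding D0_def by (intro convex_Int convex_closure) auto
  qed
  have from_local: "\<exists>e\<in>game.D. norm e > a \<and> (\<exists>Q. countable Q \<and> (\<forall>q\<in>Q. bounded_linear q) \<and>
      (\<forall>f. unit_functional f \<longrightarrow> \<not> separates_dense f Q game.D e \<epsilon>))"
    if "x \<in> D0" "finite F" "\<And>q. q \<in> F \<Longrightarrow> bounded_linear q" "\<delta> > 0"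
      "\<And>y. y \<in> D0 \<Longrightarrow> (\<And>q. q \<in> F \<Longrightarrow> \<bar>q y - q x\<bar> < \<delta>) \<Longrightarrow> norm (y - x) < \<epsilon> / 2" for x \<delta> and F :: "('a \<Rightarrow> real) set"
    using that f0 z0(2) by (intro game.small_weak_neighbourhood[OF f0(1) z0Z, of a x F \<delta>]) (auto simp: D0_def)
  have "\<exists>e\<in>game.D. norm e > a \<and> (\<exists>Q. countable Q \<and> (\<forall>q\<in>Q. bounded_linear q) \<and>
      (\<forall>f. unit_functional f \<longrightarrow> \<not> separates_dense f Q game.D e \<epsilon>))"
    using props unfolding C_def[symmetric]
  proof (elim disjE)
    assume "Radon_Nikodym_property C"
    then have "dentable D0" using D0 unfolding Radon_Nikodym_property_def by blast
    then obtain S where S: "slice_of D0 S" "diameter S < \<epsilon> / 2"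
      using \<epsilon> unfolding dentable_def by (meson half_gt_zero)
    then obtain g :: "'a \<Rightarrow> real" and b x where g: "bounded_linear g" "S = D0 \<inter> {x. g x > b}" and x: "x \<in> S"
      unfolding slice_of_def by blast
    \<comment> \<open>The real-valued \<open>diameter\<close> bounds distances only for bounded
      sets.\<close>
    have "bounded S" using bounded D0(1) g(2) bounded_subset by blast
    show ?thesis
    proof (rule from_local[of x "{g}" "g x - b"])
      fix y assume "y \<in> D0" "\<And>q. q \<in> {g} \<Longrightarrow> \<bar>q y - q x\<bar> < g x - b"
      then have "y \<in> S" using g(2) by fastforce
      then have "dist y x \<le> diameter S" using x \<open>bounded S\<close> by (intro diameter_bounded_bound)
      then show "norm (y - x) < \<epsilon> / 2" using S(2) by (simp add: dist_norm)
    qed (use x g in auto)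
  next
    assume "convex_point_of_continuity_property scaleK C"
    then obtain x where x: "x \<in> D0" "topcontinuous_at (subtopology (weak_topology scaleK) D0) (top_of_set D0) id x"
      using D0 unfolding convex_point_of_continuity_property_def by blast
    have "openin (top_of_set D0) (D0 \<inter> ball x (\<epsilon> / 2)) \<and> id x \<in> D0 \<inter> ball x (\<epsilon> / 2)"
      using x(1) \<epsilon> by (simp add: openin_open_Int)
    moreover have "\<forall>V. openin (top_of_set D0) V \<and> id x \<in> V \<longrightarrow>
        (\<exists>U. openin (subtopology (weak_topology scaleK) D0) U \<and> x \<in> U \<and> (\<forall>y\<in>U. id y \<in> V))"
      using x(2) unfolding topcontinuous_at_def by (elim conjE)
    ultimately obtain U where "openin (subtopology (weak_topology scaleK) D0) U" "x \<in> U"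
        "\<forall>y\<in>U. id y \<in> D0 \<inter> ball x (\<epsilon> / 2)" by meson
    then have U: "openin (subtopology (weak_topology scaleK) D0) U" "x \<in> U" "U \<subseteq> ball x (\<epsilon> / 2)"
      by auto
    then obtain S where S: "openin (weak_topology scaleK) S" "U = S \<inter> D0"
      by (auto simp: openin_subtopology)
    then obtain F :: "('a \<Rightarrow> real) set" and \<delta> where F: "finite F" "\<forall>q\<in>F. bounded_linear q" "\<delta> > 0"
      "\<forall>y. (\<forall>q\<in>F. \<bar>q y - q x\<bar> < \<delta>) \<longrightarrow> y \<in> S"
      using weakly_open_nbhd[OF S(1), of x] U(2) by blast
    show ?thesis
    proof (rule from_local[of x F \<delta>])
      fix y assume "y \<in> D0" "\<And>q. q \<in> F \<Longrightarrow> \<bar>q y - q x\<bar> < \<delta>"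
      then have "y \<in> ball x (\<epsilon> / 2)" using F(4) S(2) U(3) by blast
      then show "norm (y - x) < \<epsilon> / 2" by (simp add: dist_norm norm_minus_commute)
    qed (use x F in auto)
  next
    assume "Asplund_property scaleK C"
    moreover have "slp ` Z \<subseteq> C" using slpZ unfolding C_def by (meson closure_subset hull_subset order_trans)
    moreover have "countable (slp ` Z)" using Z(1) by simp
    ultimately obtain Q :: "('a \<Rightarrow> 'k) set" where Q: "Q \<subseteq> dual_space scaleK" "countable Q"
      "\<And>f r. f \<in> dual_space scaleK \<Longrightarrow> r > 0 \<Longrightarrow> \<exists>q\<in>Q. sup_seminorm (slp ` Z) (\<lambda>x. f x - q x) < r"
      unfolding Asplund_property_def by meson
    have "\<not> separates_dense f (re ` Q) game.D (slp z0) \<epsilon>" if f: "unit_functional f" for f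
    proof
      assume sep: "separates_dense f (re ` Q) game.D (slp z0) \<epsilon>"
      obtain g where g: "g \<in> dual_ball" "re g = f" using functional_lift[OF f] by blast
      have gd: "g \<in> dual_space scaleK" using g(1) by (simp add: dual_ball_def)
      \<comment> \<open>Three errors of at most \<open>\<epsilon> / 4\<close> (\<open>f\<close>
        against \<open>re q\<close> at two points, and the variation of \<open>re q\<close>) cannot
        add up to a drop by \<open>\<epsilon>\<close>.\<close>
      obtain q where q: "q \<in> Q" "sup_seminorm (slp ` Z) (\<lambda>x. g x - q x) < \<epsilon> / 4"
        using Q(3)[OF gd, of "\<epsilon> / 4"] \<epsilon> by auto
      have qd: "q \<in> dual_space scaleK" using q(1) Q(1) by blast
      have "bounded_linear (\<lambda>x. g x - q x)"
        using gd qd by (intro bounded_linear_sub dual_space_bounded_linear)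
      then obtain k where k: "k > 0" "\<And>x. norm (g x - q x) \<le> norm x * k"
        using bounded_linear.pos_bounded by blast
      have "norm (g (slp m) - q (slp m)) \<le> L * k" if "m \<in> Z" for m
        using k(2)[of "slp m"] norm_slp[of m] that Z(2) k(1) by (meson less_imp_le mult_right_mono order_trans subsetD)
      \<comment> \<open>Boundedness makes the \<open>Sup\<close> in \<open>sup_seminorm\<close> a
        genuine upper bound.\<close>
      then have bdd: "bdd_above (insert 0 ((\<lambda>b. norm (g b - q b)) ` slp ` Z))"
        by (auto intro!: bdd_aboveI[of _ "max 0 (L * k)"] simp: le_max_iff_disj)
      have close: "\<bar>f (slp m) - re q (slp m)\<bar> \<le> \<epsilon> / 4" if "m \<in> Z" for m
      proof -
        have "\<bar>f (slp m) - re q (slp m)\<bar> \<le> norm (g (slp m) - q (slp m))"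
          using abs_Re_le_cmod[of "emb (g (slp m) - q (slp m))"] unfolding g(2)[symmetric]
          by (simp add: re_def emb_diff norm_emb[symmetric])
        also have "\<dots> \<le> sup_seminorm (slp ` Z) (\<lambda>x. g x - q x)"
          unfolding sup_seminorm_def using bdd that by (intro cSup_upper) auto
        finally show ?thesis using q(2) by simp
      qed
      have lin: "linear (\<lambda>x. f x - re q x)"
        using unit_functional_bounded_linear[OF f] re_bounded_linear[OF qd]
        by (intro bounded_linear.linear bounded_linear_sub)
      have "convex hull (slp ` Z) \<subseteq> (\<lambda>x. f x - re q x) -` cball 0 (\<epsilon> / 4)"
      proof (intro hull_minimal convex_linear_vimage[OF lin])
        show "slp ` Z \<subseteq> (\<lambda>x. f x - re q x) -` cball 0 (\<epsilon> / 4)"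
          using close by (simp add: image_subset_iff)
      qed (rule convex_cball)
      then have closeD: "\<bar>f x - re q x\<bar> \<le> \<epsilon> / 4" if "x \<in> game.D" for x
        using game.D_subset_hull that by fastforce
      obtain b where b: "b \<in> game.D" "\<bar>re q b - re q (slp z0)\<bar> < \<epsilon> / 4" "f b \<le> f (slp z0) - \<epsilon>"
        using separates_denseD[OF sep, of "{re q}" "slp z0" "\<epsilon> / 4"] q(1) \<epsilon> game.slp_mem_D[OF z0Z] by auto
      show False
        using closeD[OF b(1)] closeD[OF game.slp_mem_D[OF z0Z]] b(2,3) \<epsilon> by linarith
    qed
    moreover have "countable (re ` Q)" "\<forall>q\<in>re ` Q. bounded_linear q"
      using Q(1,2) re_bounded_linear by auto
    ultimately show ?thesis using game.slp_mem_D[OF z0Z] z0(2) by blast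
  next
    assume no: "no_l1_sequences scaleK C"
    have "small game.D (slp z0) \<epsilon> dual_ball"
    proof (rule ccontr)
      assume "\<not> ?thesis"
      then obtain d where "range d \<subseteq> game.D" "equivalent_to_l1_basis scaleK d"
        using l1_sequence_if_not_small[OF game.countable_D game.slp_mem_D[OF z0Z] game.norm_D \<epsilon>] by blast
      then show False using no DC unfolding no_l1_sequences_def by blast
    qed
    then obtain Q :: "('a \<Rightarrow> real) set" where Q: "countable Q" "\<forall>q\<in>Q. bounded_linear q"
      "\<And>g. g \<in> dual_ball \<Longrightarrow> \<not> separates_dense (re g) Q game.D (slp z0) \<epsilon>"
      unfolding small_def by blast
    have "\<not> separates_dense f Q game.D (slp z0) \<epsilon>" if "unit_functional f" for f
      using functional_lift[OF that] Q(3) by blast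
    then show ?thesis using Q(1,2) game.slp_mem_D[OF z0Z] z0(2) by blast
  qed
  then obtain e and Q :: "('a \<Rightarrow> real) set" where eQ: "e \<in> game.D" "norm e > a" "countable Q" "\<forall>q\<in>Q. bounded_linear q"
    "\<And>f. unit_functional f \<Longrightarrow> \<not> separates_dense f Q game.D e \<epsilon>" by blast
  obtain m where "m \<in> Z" "norm (vec m + slp m) > 1 + norm e - 3 * \<epsilon>"
    using game.winning_move[OF eQ(1,3) _ eQ(5)] eQ(4) by blast
  then show ?thesis using Z(2) eQ(2) by (intro bexI[of _ m]) (auto simp: a_def)
qed

text \<open>The embedded scalars are closed in the complex plane, so the unit scalars inherit
  compactness from the circle.\<close>

lemma unit_scalar_convergent_subsequence:
  assumes "\<And>n. norm (\<theta> n :: 'k) = 1"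
  obtains \<theta>0 and r :: "nat \<Rightarrow> nat" where "norm \<theta>0 = 1" "strict_mono r" "(\<theta> \<circ> r) \<longlonglongrightarrow> \<theta>0"
proof -
  have "\<forall>n. emb (\<theta> n) \<in> sphere 0 1 \<inter> range emb" using assms by (simp add: norm_emb)
  moreover have "compact (sphere 0 1 \<inter> range emb)"
    using range_emb by (intro compact_Int_closed) (auto simp: closed_complex_Reals)
  ultimately obtain z r where z: "z \<in> sphere 0 1 \<inter> range emb" "strict_mono r" "((\<lambda>n. emb (\<theta> n)) \<circ> r) \<longlonglongrightarrow> z"
    by (meson compact_def)
  then obtain \<theta>0 where \<theta>0: "z = emb \<theta>0" "norm \<theta>0 = 1" by (auto simp: norm_emb)
  have "(\<lambda>n. norm (emb (\<theta> (r n)) - emb \<theta>0)) \<longlonglongrightarrow> 0"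
    using z(3) unfolding \<theta>0(1) o_def by (simp add: tendsto_norm_zero_iff LIM_zero)
  then have "(\<theta> \<circ> r) \<longlonglongrightarrow> \<theta>0"
    by (simp add: emb_diff[symmetric] norm_emb tendsto_norm_zero_iff LIM_zero_iff o_def)
  then show ?thesis using that \<theta>0(2) z(2) by blast
qed

text \<open>Almost optimal moves give almost optimal rotations, which may vary with the tolerance. A
  limit of a subsequence of them attains the maximum.\<close>

lemma alternative_Daugavet_equation_if_moves:
  assumes nontriv: "\<exists>x::'a. x \<noteq> 0"
    and win: "\<And>\<epsilon>. \<epsilon> > 0 \<Longrightarrow> \<exists>m\<in>moves. norm (vec m + slp m) > 1 + lip_norm T - 4 * \<epsilon>"
  shows "alternative_Daugavet_equation lip_norm scaleK T"
proof -
  let ?M = "lip_norm T"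
  define S where "S \<theta> x = x + scaleK \<theta> (T x)" for \<theta> x
  have diff: "S \<theta> x - S \<theta> y = (x - y) + scaleK \<theta> (T x - T y)" for \<theta> x y
    by (simp add: S_def scale_right_diff_distrib)
  have Tle: "norm (T x - T y) \<le> ?M * norm (x - y)" for x y
  proof (cases "x = y")
    case False
    then show ?thesis using lip_norm_upper[OF lipschitz False] by (simp add: divide_le_eq)
  qed simp
  have Sle: "norm (S \<theta> x - S \<theta> y) \<le> (1 + ?M) * norm (x - y)" if "norm \<theta> = 1" for \<theta> x y
  proof -
    have "norm (S \<theta> x - S \<theta> y) \<le> norm (x - y) + norm (scaleK \<theta> (T x - T y))"
      unfolding diff by (rule norm_triangle_ineq)
    then have "norm (S \<theta> x - S \<theta> y) \<le> norm (x - y) + norm (T x - T y)"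
      using that unfolding norm_scaleK by simp
    then show ?thesis using Tle[of x y] by (simp add: distrib_right)
  qed
  obtain x0 :: 'a where "x0 \<noteq> 0" using nontriv by blast
  then have M0: "?M \<ge> 0"
    using lip_norm_upper[OF lipschitz, of x0 0] by (meson divide_nonneg_nonneg norm_ge_zero order_trans)
  have S_lip: "(1 + ?M)-lipschitz_on UNIV (S \<theta>)" if "norm \<theta> = 1" for \<theta>
    using Sle[OF that] M0 by (intro lipschitz_onI) (auto simp: dist_norm)
  have upper: "lip_norm (S \<theta>) \<le> 1 + ?M" if "norm \<theta> = 1" for \<theta>
    using Sle[OF that] by (intro lip_norm_least[OF nontriv]) (simp add: divide_le_eq)
  have "\<exists>\<theta> x y. norm \<theta> = 1 \<and> x \<noteq> y \<and> norm (S \<theta> x - S \<theta> y) / norm (x - y) > 1 + ?M - 1 / real (Suc n)" for n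
  proof -
    define k where "k = real (Suc n)"
    have "k > 0" by (simp add: k_def)
    then obtain m where m: "m \<in> moves" "norm (vec m + slp m) > 1 + ?M - 1 / k"
      using win[of "1 / (4 * k)"] by auto
    then obtain \<theta> x y where mm: "m = (\<theta>, x, y)" "norm \<theta> = 1" "x \<noteq> y" by (auto simp: moves_def)
    then have "\<theta> \<noteq> 0" by auto
    \<comment> \<open>A move rotates the direction, whereas the equation rotates \<open>T\<close>;
      hence the inverse rotation appears.\<close>
    have "vec m + slp m = scaleK \<theta> ((S (inverse \<theta>) x - S (inverse \<theta>) y) /\<^sub>R norm (x - y))"
      using \<open>\<theta> \<noteq> 0\<close> by (simp add: mm(1) vec_def slp_def diff scaleK_scaleR scale_right_distrib scaleR_add_right)
    then have "norm (vec m + slp m) = norm (S (inverse \<theta>) x - S (inverse \<theta>) y) / norm (x - y)"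
      using mm(2) by (simp add: norm_scaleK divide_inverse mult.commute)
    then show ?thesis using m(2) mm(2,3) unfolding k_def
      by (intro exI[of _ "inverse \<theta>"] exI[of _ x] exI[of _ y]) (simp only: norm_inverse, simp)
  qed
  then obtain \<theta> x y where seq: "\<And>n. norm (\<theta> n) = 1" "\<And>n. x n \<noteq> y n"
    "\<And>n. norm (S (\<theta> n) (x n) - S (\<theta> n) (y n)) / norm (x n - y n) > 1 + ?M - 1 / real (Suc n)"
    by metis
  obtain \<theta>0 and r :: "nat \<Rightarrow> nat" where \<theta>0: "norm \<theta>0 = 1" "strict_mono r" "(\<theta> \<circ> r) \<longlonglongrightarrow> \<theta>0"
    by (rule unit_scalar_convergent_subsequence[of \<theta>, OF seq(1)])
  \<comment> \<open>Replacing \<open>\<theta> n\<close> by \<open>\<theta>0\<close> changes a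
    quotient by at most \<open>norm (\<theta> n - \<theta>0) * ?M\<close>, which tends to zero along
    \<open>r\<close>.\<close>
  have lower: "1 + ?M - 1 / real (Suc n) - norm (\<theta> n - \<theta>0) * ?M \<le> lip_norm (S \<theta>0)" for n
  proof -
    have "S (\<theta> n) (x n) - S (\<theta> n) (y n) = (S \<theta>0 (x n) - S \<theta>0 (y n)) + scaleK (\<theta> n - \<theta>0) (T (x n) - T (y n))"
      by (simp add: diff scale_left_diff_distrib)
    then have "norm (S (\<theta> n) (x n) - S (\<theta> n) (y n))
        \<le> norm (S \<theta>0 (x n) - S \<theta>0 (y n)) + norm (\<theta> n - \<theta>0) * norm (T (x n) - T (y n))"
      by (metis norm_scaleK norm_triangle_ineq)
    also have "\<dots> \<le> norm (S \<theta>0 (x n) - S \<theta>0 (y n)) + norm (\<theta> n - \<theta>0) * (?M * norm (x n - y n))"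
      using Tle by (intro add_left_mono mult_left_mono) auto
    finally have "norm (S (\<theta> n) (x n) - S (\<theta> n) (y n)) / norm (x n - y n)
        \<le> (norm (S \<theta>0 (x n) - S \<theta>0 (y n)) + norm (\<theta> n - \<theta>0) * (?M * norm (x n - y n))) / norm (x n - y n)"
      by (rule divide_right_mono) simp
    also have "\<dots> = norm (S \<theta>0 (x n) - S \<theta>0 (y n)) / norm (x n - y n) + norm (\<theta> n - \<theta>0) * ?M"
      using seq(2)[of n] by (simp add: add_divide_distrib)
    finally show ?thesis
      using seq(3)[of n] lip_norm_upper[OF S_lip[OF \<theta>0(1)] seq(2)[of n]] by linarith
  qed
  have "(\<lambda>n. 1 + ?M - 1 / real (Suc (r n)) - norm (\<theta> (r n) - \<theta>0) * ?M) \<longlonglongrightarrow> 1 + ?M - 0 - 0 * ?M"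
  proof (intro tendsto_intros)
    show "(\<lambda>n. 1 / real (Suc (r n))) \<longlonglongrightarrow> 0"
      using LIMSEQ_subseq_LIMSEQ[OF LIMSEQ_inverse_real_of_nat \<theta>0(2)]
      by (simp add: o_def inverse_eq_divide)
    show "(\<lambda>n. norm (\<theta> (r n) - \<theta>0)) \<longlonglongrightarrow> 0"
      using \<theta>0(3) by (simp add: tendsto_norm_zero_iff LIM_zero_iff o_def)
  qed
  then have "1 + ?M \<le> lip_norm (S \<theta>0)"
    using lower by (intro LIMSEQ_le_const2) auto
  then have attained: "1 + ?M = lip_norm (S \<theta>0)" using upper[OF \<theta>0(1)] by simp
  have S_eq: "S \<theta> = (\<lambda>x. x + scaleK \<theta> (T x))" for \<theta> by (simp add: S_def fun_eq_iff)
  show ?thesis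
    unfolding alternative_Daugavet_equation_def is_maximum_def S_eq[symmetric]
  proof (intro conjI ballI)
    show "1 + ?M \<in> {lip_norm (S \<theta>) |\<theta>. norm \<theta> = 1}"
      using attained \<theta>0(1) by (intro CollectI exI[of _ \<theta>0]) simp
  next
    fix s assume "s \<in> {lip_norm (S \<theta>) |\<theta>. norm \<theta> = 1}"
    then show "s \<le> 1 + ?M" using upper by auto
  qed
qed

end

text \<open>Real scalars are placed on the real axis, which accounts for the two possible
  ranges.\<close>

lemma ex_scalar_embedding:
  obtains emb :: "'k::real_or_complex_field \<Rightarrow> complex" where
    "\<And>x y. emb (x + y) = emb x + emb y" "\<And>x y. emb (x * y) = emb x * emb y"
    "\<And>x. norm (emb x) = norm x" "range emb = UNIV \<or> range emb = \<real>"
  using real_or_complex[where 'a = 'k]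
proof (elim disjE exE conjE)
  fix \<phi> :: "'k \<Rightarrow> real"
  assume \<phi>: "bij \<phi>" "\<forall>x y. \<phi> (x + y) = \<phi> x + \<phi> y" "\<forall>x y. \<phi> (x * y) = \<phi> x * \<phi> y" "\<forall>x. norm (\<phi> x) = norm x"
  have "range (\<lambda>x. complex_of_real (\<phi> x)) = of_real ` range \<phi>" by (simp add: image_image)
  then have "range (\<lambda>x. complex_of_real (\<phi> x)) = \<real>" using \<phi>(1) by (simp add: bij_is_surj Reals_def)
  then show thesis using that[of "\<lambda>x. of_real (\<phi> x)"] \<phi> by simp
next
  fix \<phi> :: "'k \<Rightarrow> complex"
  assume \<phi>: "bij \<phi>" "\<forall>x y. \<phi> (x + y) = \<phi> x + \<phi> y" "\<forall>x y. \<phi> (x * y) = \<phi> x * \<phi> y" "\<forall>x. norm (\<phi> x) = norm x"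
  then show thesis using that[of \<phi>] by (simp add: bij_is_surj)
qed

theorem corollary3p8:
  fixes scaleK :: "'k::real_or_complex_field \<Rightarrow> 'a::banach \<Rightarrow> 'a"
    and T :: "'a \<Rightarrow> 'a"
  assumes "banach_space_over scaleK"
    and "\<exists>x::'a. x \<noteq> 0"
    and "alternative_Daugavet_property scaleK"
    and "T \<in> Lip"
    and "Radon_Nikodym_property (closure (convex hull (slope T))) \<or>
         Asplund_property scaleK (closure (convex hull (slope T))) \<or>
         convex_point_of_continuity_property scaleK (closure (convex hull (slope T))) \<or>
         no_l1_sequences scaleK (closure (convex hull (slope T)))"
  shows "alternative_Daugavet_equation lip_norm scaleK T"
proof -
  obtain emb :: "'k \<Rightarrow> complex" where emb:
    "\<And>x y. emb (x + y) = emb x + emb y" "\<And>x y. emb (x * y) = emb x * emb y"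
    "\<And>x. norm (emb x) = norm x" "range emb = UNIV \<or> range emb = \<real>"
    by (rule ex_scalar_embedding) (rule that)
  obtain L where L: "L-lipschitz_on UNIV T" using assms(4) by (auto simp: Lip_def)
  interpret banach_space_over scaleK by fact
  interpret lipschitz_map scaleK emb T L
    using emb assms(3) L by unfold_locales auto
  show ?thesis
    using winning_move_if[OF assms(2) _ assms(5)] by (rule alternative_Daugavet_equation_if_moves[OF assms(2)])
qed

end
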